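(* Let $0\le c\le 1$ and $K$ a positive integer. Let $A:[0,1)^2\to[0,1]$ be a function with $\int_0^1\int_0^1 A(x,y)\,\mathrm{d}x\,\mathrm{d}y=c$ and $A(x,y)=A(y,x)$ for all $0\le x,y<1$, and suppose there are numbers $0=q_0<q_1<\dots<q_K=1$ such that $A$ is constant on each rectangle $[q_{i-1},q_i)\times[q_{j-1},q_j)$, $1\le i,j\le K$. For $x\in[0,1)$ let $\ell(x)=\int_0^1 A(x,y)\,\mathrm{d}y$ and let $$S(A)=\int_0^1\int_0^1 \ell(x)\ell(y)\min(\ell(x),\ell(y))\,\mathrm{d}x\,\mathrm{d}y.$$ Let $A_1(c):[0,1)^2\to[0,1]$ be defined by $A_1(c)(x,y)=1$ if $\min(x,y)<1-\sqrt{1-c}$ and $0$ otherwise, and $A_2(c):[0,1)^2\to[0,1]$ by $A_2(c)(x,y)=1$ if $\max(x,y)<\sqrt{c}$ and $0$ otherwise. Then $$S(A)\le \max\big(S(A_1(c)),S(A_2(c))\big)=\max\Big((1-\sqrt{1-c})^2\big((c+1)\sqrt{1-c}+c\big),\ c^{5/2}\Big).$$ *)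

theory Defs
  imports "HOL-Analysis.Analysis"
begin

text \<open>
  A kernel on \<open>[0,1)\<^sup>2\<close> is represented by a total curried function; every notion below
  only looks at its values on \<open>{0..<1}\<close>.
\<close>

definition deg :: "(real \<Rightarrow> real \<Rightarrow> real) \<Rightarrow> real \<Rightarrow> real" where
  "deg A x = (LBINT y:{0..<1}. A x y)"

definition S :: "(real \<Rightarrow> real \<Rightarrow> real) \<Rightarrow> real" where
  "S A = (LBINT y:{0..<1}. LBINT x:{0..<1}. deg A x * deg A y * min (deg A x) (deg A y))"

definition A1 :: "real \<Rightarrow> real \<Rightarrow> real \<Rightarrow> real" where
  "A1 c x y = (if min x y < 1 - sqrt (1 - c) then 1 else 0)"

definition A2 :: "real \<Rightarrow> real \<Rightarrow> real \<Rightarrow> real" where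
  "A2 c x y = (if max x y < sqrt c then 1 else 0)"

end

theory Submission
  imports Defs
begin

text \<open>
  Rearranging the steps, let the degree function \<open>l\<close> be nonincreasing, and put \<open>L t = \<integral>\<^sub>0\<^sup>t l\<close>; then
  \<open>S = 2 \<integral> L l\<^sup>2\<close>. Cut at the point \<open>a\<close> where \<open>l\<close> crosses the diagonal and write \<open>L t = a t + V t\<close> on \<open>[0,a]\<close>,
  \<open>x = V a\<close>, \<open>b = \<integral>\<^sub>a\<^sup>1 l\<close>, \<open>q = \<integral>\<^sub>0\<^sup>a V\<close>, \<open>G = \<integral>\<^sub>a\<^sup>1 l\<^sup>2\<close>.
  On \<open>[0,a]\<close> concavity of \<open>V\<close> gives pointwise bounds for \<open>L l\<^sup>2\<close> which integrate exactly up to a multiple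
  of \<open>q\<close>; on \<open>[a,1]\<close> a Chebyshev argument gives \<open>2 \<integral> L l\<^sup>2 \<le> (2 c - b) G\<close>. The kernel enters only through
  \<open>x \<le> b\<close> and \<open>q + G / 2 \<le> a b\<close>, which follow by applying the bathtub principle to each column of \<open>A\<close>.
  What remains is a polynomial inequality in \<open>a, x, b, q, G\<close>, linear in \<open>q\<close> and \<open>G\<close>; according to the signs of
  the coefficients the bound is compared with the clique value \<open>c\<^bsup>5/2\<^esup>\<close> or with the star value.
\<close>

subsection \<open>The polynomial inequality\<close>

text \<open>With \<open>c = a^2 * v\<close> the clique value is \<open>a^5 * v^(5/2)\<close>. After
  taking out \<open>a^5\<close>, a comparison with it is one between polynomials in
  \<open>v\<close>.\<close>

lemma scaled_le_sqrt_power5: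
  fixes a n v :: real
  assumes "0 \<le> a" "n\<^sup>2 \<le> v ^ 5"
  shows "a ^ 5 * n \<le> sqrt ((a\<^sup>2 * v) ^ 5)"
proof (rule real_le_rsqrt)
  have "(a ^ 5 * n)\<^sup>2 = a ^ 10 * n\<^sup>2"
    by (simp add: power_mult_distrib flip: power_mult)
  also have "\<dots> \<le> a ^ 10 * v ^ 5"
    using assms by (intro mult_left_mono) auto
  also have "\<dots> = (a\<^sup>2 * v) ^ 5"
    by (simp add: power_mult_distrib flip: power_mult)
  finally show "(a ^ 5 * n)\<^sup>2 \<le> (a\<^sup>2 * v) ^ 5" .
qed

text \<open>This is \<open>S (A1 c)\<close>: with \<open>s = 1 - sqrt (1 - c)\<close> that kernel
  has degree \<open>1\<close> on \<open>[0,s)\<close> and \<open>s\<close> on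
  \<open>[s,1)\<close>.\<close>

definition star_value :: "real \<Rightarrow> real" where
  "star_value c = (1 - sqrt (1 - c))\<^sup>2 * ((c + 1) * sqrt (1 - c) + c)"

text \<open>The lower bound is the cubic Taylor polynomial of \<open>star_value\<close> at
  \<open>c = 0\<close>; in the parameter \<open>s\<close> the remainder is a polynomial with the
  factor \<open>s^4\<close>.\<close>

lemma star_value_ge:
  assumes "0 \<le> c" "c \<le> 1"
  shows "c\<^sup>2 / 4 * (1 + 2 * c) \<le> star_value c"
proof -
  define s where "s = 1 - sqrt (1 - c)"
  have s: "0 \<le> s" "s \<le> 1" and r: "sqrt (1 - c) = 1 - s"
    using assms by (auto simp: s_def)
  have "(1 - s)\<^sup>2 = 1 - c"
    using assms by (simp flip: r)
  then have c: "c = 2 * s - s\<^sup>2"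
    by (simp add: power2_eq_square algebra_simps)
  have "star_value c - c\<^sup>2 / 4 * (1 + 2 * c) = s ^ 4 * ((1 - s) * (3 - s) + 1 / 2) / 2"
    unfolding star_value_def r unfolding c by (simp add: field_simps eval_nat_numeral)
  moreover have "\<dots> \<ge> 0"
    using s by simp
  ultimately show ?thesis by linarith
qed

text \<open>
  The left-hand side is the value of \<open>S\<close> for the threshold kernel with degrees \<open>1\<close> on \<open>[0,h)\<close>, \<open>a\<close> on \<open>[h,a)\<close>
  and \<open>h\<close> on \<open>[a,1)\<close>, where \<open>h = w / (1 - a)\<close>: a star together with a clique.
\<close>

lemma star_with_clique_le_star_value:
  fixes a w :: real
  assumes a: "0 < a" "4 * a < 1" and w: "0 \<le> w" "w \<le> a * (1 - a)"
    and k: "3 * a ^ 3 \<le> w * (1 - 4 * a)"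
  shows "a ^ 5 + 2 * a ^ 3 * w + 3 * a * w\<^sup>2 + (1 - a) * w\<^sup>2 + 3 * w\<^sup>2 * (a\<^sup>2 + w) / (1 - a)
    \<le> star_value (a\<^sup>2 + 2 * w)" (is "?hi \<le> _")
proof -
  define D where "D = 1 - a"
  define c where "c = a\<^sup>2 + 2 * w"
  \<comment> \<open>The star of mass \<open>c\<close> has width
    \<open>1 - sqrt (1 - c) = a - e\<close>. At \<open>e = 0\<close> the star with clique is itself
    that star, and the difference of the two values below carries the factor
    \<open>e^2\<close>.\<close>
  define e where "e = sqrt (1 - c) - D"
  have aD: "a = 1 - D" and D: "3/4 < D" "D < 1"
    using a by (auto simp: D_def)
  have "1 - c \<ge> D\<^sup>2"
    using w by (simp add: c_def D_def power2_eq_square algebra_simps)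
  then have "sqrt (1 - c) \<ge> D" and c1: "1 - c \<ge> 0"
    using order_trans[OF zero_le_power2] by (blast intro: real_le_rsqrt)+
  then have e0: "0 \<le> e" by (simp add: e_def)
  have r: "sqrt (1 - c) = D + e" by (simp add: e_def)
  then have r2: "1 - c = (D + e)\<^sup>2"
    using c1 by (metis real_sqrt_pow2)
  then have w2: "w = (2 * D * (1 - D) - 2 * D * e - e\<^sup>2) / 2"
    by (simp add: c_def aD power2_eq_square algebra_simps)
  have ea: "e \<le> a"
  proof -
    have "D * e \<le> D * (1 - D)"
    proof -
      have "D * (1 - D) - D * e = w + e\<^sup>2 / 2" using w2 by (simp add: field_simps)
      with w(1) zero_le_power2[of e] show ?thesis by linarith
    qed
    then show ?thesis using D by (simp add: aD)
  qed
  have hi: "4 * D * ?hi = 4 * D * (a ^ 5 + 2 * a ^ 3 * w + 3 * a * w\<^sup>2 + D * w\<^sup>2) + 12 * w\<^sup>2 * (a\<^sup>2 + w)"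
    using D by (simp add: D_def[symmetric] field_simps)
  have cc: "c = 1 - (D + e)\<^sup>2" using r2 by linarith
  have "4 * D * star_value c - 4 * D * ?hi =
    e\<^sup>2 * (2 * D * w * (3 - D - e) + e\<^sup>2 * (3 * D\<^sup>2 + D - 3 + 4 * D * e + 3/2 * e\<^sup>2))"
    unfolding hi star_value_def r unfolding cc aD w2 by (simp add: field_simps eval_nat_numeral)
  moreover have "0 \<le> 2 * D * w * (3 - D - e) + e\<^sup>2 * (3 * D\<^sup>2 + D - 3 + 4 * D * e + 3/2 * e\<^sup>2)"
  proof -
    have p1: "0 \<le> e\<^sup>2 * (4 * D * e + 3/2 * e\<^sup>2)"
      using e0 D by simp
    have p2: "2 * D * w * (3 - D - e) \<ge> 2 * D * w * 1"
      using e0 ea D w by (intro mult_left_mono) (auto simp: aD)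
    have "2 * D * w \<ge> 3/2 * w" using D w by (intro mult_right_mono) auto
    with p2 have p3: "2 * D * w * (3 - D - e) \<ge> 3/2 * w" by linarith
    \<comment> \<open>Only \<open>3 * D^2 + D - 3\<close> can be negative. It is nonnegative for
      \<open>D >= 17/20\<close>; otherwise \<open>a >= 3/20\<close>, and \<open>k\<close> forces
      \<open>w >= e^2\<close>, which compensates for it.\<close>
    show ?thesis
    proof (cases "D \<ge> 17/20")
      case True
      then have "D\<^sup>2 \<ge> (17/20)\<^sup>2" by (intro power_mono) auto
      with True have "3 * D\<^sup>2 + D - 3 \<ge> 0" by (simp add: power2_eq_square)
      then have "0 \<le> e\<^sup>2 * (3 * D\<^sup>2 + D - 3)" by simp
      with p1 p3 w(1) show ?thesis by (simp add: distrib_left right_diff_distrib)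
    next
      case False
      then have "a \<ge> 3/20" by (simp add: aD)
      have "w * (1 - 4 * a) \<le> w * (2/5)"
        using \<open>a \<ge> 3/20\<close> w by (intro mult_left_mono) auto
      with k have "w \<ge> 15/2 * a ^ 3" by linarith
      moreover have "a ^ 3 \<ge> 3/20 * a\<^sup>2"
        using \<open>a \<ge> 3/20\<close> by (simp add: power3_eq_cube power2_eq_square mult_right_mono)
      moreover have "e\<^sup>2 \<le> a\<^sup>2" using e0 ea by (intro power_mono)
      ultimately have we: "w \<ge> e\<^sup>2" using zero_le_power2[of a] by linarith
      have "D\<^sup>2 \<ge> (3/4)\<^sup>2" using D by (intro power_mono) auto
      then have "3 * D\<^sup>2 + D - 3 \<ge> -1"
        using D by (simp add: power2_eq_square)
      then have "e\<^sup>2 * (3 * D\<^sup>2 + D - 3) \<ge> e\<^sup>2 * (-1)" by (intro mult_left_mono) auto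
      with p1 p3 we w(1) show ?thesis by (simp add: distrib_left right_diff_distrib)
    qed
  qed
  ultimately have "4 * D * ?hi \<le> 4 * D * star_value c"
    by (metis diff_ge_0_iff_ge mult_nonneg_nonneg zero_le_power2)
  then show ?thesis using D by (simp add: c_def)
qed

section \<open>The polynomial inequality as a linear program in \<open>q\<close> and
  \<open>G\<close>\<close>

text \<open>The left-hand side adds the bounds of \<open>head_bound\<close> and
  \<open>tail_bound\<close>, with \<open>x = V a\<close> and \<open>c = L 1\<close>. It is linear in
  \<open>q\<close> and \<open>G\<close>; the signs of \<open>X\<close> and \<open>P - X\<close>
  decide which two constraints are used with equality: least \<open>q\<close> and
  \<open>G = a b\<close>, or greatest \<open>q\<close> and \<open>G = 2 (a b - q)\<close>, or
  \<open>G = a b = 2 (a b - q)\<close>.\<close>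

lemma degree_polynomial_bound:
  fixes a x b q G :: real
  assumes a: "0 < a" "a < 1" and x: "0 \<le> x" "x \<le> b" and b: "b \<le> a * (1 - a)"
    and q: "a * x / 2 \<le> q" "q \<le> a * x - x\<^sup>2 / (2 * (1 - a))"
    and G: "G \<le> a * b" "G \<le> 2 * (a * b - q)"
    and c: "c = a\<^sup>2 + x + b"
  shows "a ^ 5 + 4 * a ^ 3 * x + 3 * a * x\<^sup>2 - (1 - a) * x\<^sup>2 + x ^ 3 / a
      + (2 * (1 - a) * x / a - 2 * a\<^sup>2) * q + (2 * c - b) * G
    \<le> max (star_value c) (sqrt (c ^ 5))" (is "?B \<le> _")
proof -
  define D where "D = 1 - a"
  \<comment> \<open>Both extremal values depend only on \<open>c = a^2 + 2 w\<close>, so the aim is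
    to replace \<open>x\<close> and \<open>b\<close> by their mean \<open>w\<close>. The scaled mean
    \<open>u\<close> makes the comparisons with the clique polynomial inequalities in one
    variable.\<close>
  define w where "w = (x + b) / 2"
  define u where "u = w / a\<^sup>2"
  define P where "P = 2 * a\<^sup>2 + 2 * x + b"
  define X where "X = D * x / a - a\<^sup>2"
  have D: "0 < D" "D < 1" using a by (auto simp: D_def)
  have P: "P \<ge> 0" using x by (simp add: P_def)
  have w: "x \<le> w" "w \<le> b" "0 \<le> w" "w \<le> a * D" using x b by (auto simp: w_def D_def)
  have u: "0 \<le> u" "w = a\<^sup>2 * u" using w a by (auto simp: u_def)
  have au: "a * u \<le> D" using w(4) a by (simp add: u power2_eq_square mult.assoc)
  have cu: "c = a\<^sup>2 * (1 + 2 * u)"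
    unfolding c using u(2) by (simp add: w_def algebra_simps)
  have c2: "c = a\<^sup>2 + 2 * w" by (simp add: c w_def)
  have c01: "0 \<le> c" "c \<le> 1"
  proof -
    show "0 \<le> c" using x by (simp add: c)
    have "c \<le> 1 - (1 - a)\<^sup>2" using w by (simp add: c2 D_def power2_eq_square algebra_simps)
    then show "c \<le> 1" by (smt (verit) zero_le_power2)
  qed
  have clique: "E \<le> sqrt (c ^ 5)" if "E = a ^ 5 * n" "n\<^sup>2 \<le> (1 + 2 * u) ^ 5" for E n
    using scaled_le_sqrt_power5[of a n "1 + 2 * u"] that a by (simp add: cu)
  have xx: "x\<^sup>2 \<le> w\<^sup>2" using x w by (intro power_mono)
  have B: "?B = a ^ 5 + 4 * a ^ 3 * x + 3 * a * x\<^sup>2 - D * x\<^sup>2 + x ^ 3 / a + 2 * X * q + P * G"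
    by (simp add: X_def P_def D_def c algebra_simps)
  have aX: "a * X = D * x - a ^ 3"
    using a by (simp add: X_def field_simps power2_eq_square power3_eq_cube)
  consider "X \<le> 0" | "0 \<le> X" "P \<le> X" | "0 \<le> X" "X \<le> P" by linarith
  then show ?thesis
  proof cases
    case 1
    have "X * q \<le> X * (a * x / 2)" using 1 q by (intro mult_left_mono_neg)
    moreover have "X * (a * x / 2) = (D * x\<^sup>2 - a ^ 3 * x) / 2"
      using arg_cong[OF aX, of "\<lambda>z. z * x / 2"] by (simp add: algebra_simps power2_eq_square)
    moreover have "P * G \<le> P * (a * b)" using P G by (intro mult_left_mono)
    ultimately have "?B \<le> a ^ 5 + 3 * a ^ 3 * x + 3 * a * x\<^sup>2 + x ^ 3 / a + P * (a * b)"
      unfolding B by (simp add: algebra_simps)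
    also have "\<dots> = a ^ 5 + a ^ 3 * (3 * x + 2 * b) + a * (3 * x\<^sup>2 + 2 * x * b + b\<^sup>2) + x ^ 3 / a"
      by (simp add: P_def algebra_simps power2_eq_square power3_eq_cube)
    also have "\<dots> \<le> a ^ 5 + a ^ 3 * (5 * w) + a * (6 * w\<^sup>2) + a * w\<^sup>2"
    proof -
      have "a ^ 3 * (3 * x + 2 * b) \<le> a ^ 3 * (5 * w)"
        using a x by (intro mult_left_mono) (auto simp: w_def)
      moreover have "a * (3 * x\<^sup>2 + 2 * x * b + b\<^sup>2) \<le> a * (6 * w\<^sup>2)"
      proof -
        have "0 \<le> (b - x) * (b + 3 * x)" using x by simp
        then show ?thesis
          using a by (intro mult_left_mono) (auto simp: w_def power2_eq_square field_simps)
      qed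
      moreover have "x ^ 3 / a \<le> a * w\<^sup>2"
      proof -
        \<comment> \<open>The upper bounds \<open>a^3 / D\<close> and \<open>a * D\<close> for
          \<open>x\<close> have product \<open>a^4\<close>, whence \<open>x <= a^2\<close>.\<close>
        have "D * x \<le> a ^ 3" using 1 aX a mult_nonneg_nonpos[of a X] by linarith
        have "x * x \<le> x * (a * D)" using x b by (intro mult_left_mono) (auto simp: D_def)
        also have "\<dots> = a * (D * x)" by simp
        also have "\<dots> \<le> a * a ^ 3" using a \<open>D * x \<le> a ^ 3\<close> by simp
        finally have "x\<^sup>2 \<le> (a\<^sup>2)\<^sup>2" by (simp add: power2_eq_square power3_eq_cube)
        then have "x \<le> a\<^sup>2" by (rule power2_le_imp_le) simp
        then have "x * x\<^sup>2 \<le> a\<^sup>2 * w\<^sup>2" using x xx by (intro mult_mono) auto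
        then show ?thesis using a by (simp add: field_simps power2_eq_square power3_eq_cube)
      qed
      ultimately show ?thesis by linarith
    qed
    also have "\<dots> \<le> sqrt (c ^ 5)"
    proof (rule clique)
      show "a ^ 5 + a ^ 3 * (5 * w) + a * (6 * w\<^sup>2) + a * w\<^sup>2 = a ^ 5 * (1 + 5 * u + 7 * u\<^sup>2)"
        unfolding u by algebra
      have "(1 + 2 * u) ^ 5 - (1 + 5 * u + 7 * u\<^sup>2)\<^sup>2 = u\<^sup>2 + 10 * u ^ 3 + 31 * u ^ 4 + 32 * u ^ 5"
        by algebra
      moreover have "\<dots> \<ge> 0" using u by simp
      ultimately show "(1 + 5 * u + 7 * u\<^sup>2)\<^sup>2 \<le> (1 + 2 * u) ^ 5" by linarith
    qed
    finally show ?thesis by simp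
  next
    case 2
    define d where "d = (b - x) / 2"
    have d: "0 \<le> d" "b = x + 2 * d" "w = x + d" using x by (auto simp: d_def w_def field_simps)
    \<comment> \<open>The condition \<open>P <= X\<close> forces \<open>3 a < D\<close>, that is
      \<open>a < 1/4\<close>, and the star becomes the competitor.\<close>
    have PX: "a * P \<le> D * x - a ^ 3" using 2 a by (simp flip: aX)
    then have PX': "3 * a ^ 3 + 3 * a * x + 2 * a * d \<le> D * x"
      by (simp add: P_def d power2_eq_square power3_eq_cube algebra_simps)
    have x3: "3 * (a * x) < D * x"
      using PX' a x d zero_less_power[OF a(1), of 3] mult_nonneg_nonneg[of a d] by linarith
    then have "0 < x" using x by (cases "x = 0") auto
    with x3 have D3: "3 * a < D" by (simp flip: mult.assoc)
    define Z where "Z = a * x - x\<^sup>2 / (2 * D)"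
    have "P * G \<le> P * (2 * (a * b - q))" using P G by (intro mult_left_mono)
    moreover have "(X - P) * q \<le> (X - P) * Z"
      using 2 q by (intro mult_left_mono) (auto simp: D_def Z_def)
    ultimately have "?B \<le> a ^ 5 + 4 * a ^ 3 * x + 3 * a * x\<^sup>2 - D * x\<^sup>2 + x ^ 3 / a
        + 2 * P * (a * b) + 2 * ((X - P) * Z)"
      unfolding B by (simp add: algebra_simps)
    also have "\<dots> = a ^ 5 - 2 * a ^ 3 * x - a * x\<^sup>2 + D * x\<^sup>2 + 4 * a ^ 3 * b + 2 * a * x * b
        + 2 * a * b\<^sup>2 + (3 * a\<^sup>2 + 2 * x + b) * x\<^sup>2 / D"
      using a D by (simp add: X_def P_def Z_def field_simps power2_eq_square power3_eq_cube)
    \<comment> \<open>Both sides agree at \<open>d = 0\<close>: the new value is the old one with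
      \<open>x\<close> and \<open>b\<close> moved to their mean, which is the value of a star with
      clique.\<close>
    also have "\<dots> \<le> a ^ 5 + 2 * a ^ 3 * w + 3 * a * w\<^sup>2 + D * w\<^sup>2 + 3 * w\<^sup>2 * (a\<^sup>2 + w) / D"
    proof -
      have "d * (D * d - a * d) \<ge> 0" using D3 a d by (intro mult_nonneg_nonneg) (auto intro: mult_right_mono)
      moreover have "d * (3 * a ^ 3 + 3 * a * x + 2 * a * d) \<le> d * (D * x)"
        using PX' d by (intro mult_left_mono)
      ultimately have h1: "a ^ 5 - 2 * a ^ 3 * x - a * x\<^sup>2 + D * x\<^sup>2 + 4 * a ^ 3 * b + 2 * a * x * b
        + 2 * a * b\<^sup>2 \<le> a ^ 5 + 2 * a ^ 3 * w + 3 * a * w\<^sup>2 + D * w\<^sup>2"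
        unfolding d by (simp add: algebra_simps power2_eq_square)
      have "3 * w\<^sup>2 * (a\<^sup>2 + w) - (3 * a\<^sup>2 + 2 * x + b) * x\<^sup>2
          = 3 * a\<^sup>2 * (2 * x * d + d\<^sup>2) + 7 * x\<^sup>2 * d + 9 * x * d\<^sup>2 + 3 * d ^ 3"
        unfolding d by algebra
      moreover have "\<dots> \<ge> 0" using x d by simp
      ultimately have "(3 * a\<^sup>2 + 2 * x + b) * x\<^sup>2 / D \<le> 3 * w\<^sup>2 * (a\<^sup>2 + w) / D"
        using D by (intro divide_right_mono) auto
      with h1 show ?thesis by linarith
    qed
    also have "\<dots> \<le> star_value c"
      unfolding c2 D_def
    proof (rule star_with_clique_le_star_value)
      show "4 * a < 1" using D3 by (simp add: D_def)
      have "d * (3 * a) \<le> d * D" using d D3 by (intro mult_left_mono) auto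
      moreover have "0 \<le> a * d" using a d by simp
      ultimately show "3 * a ^ 3 \<le> w * (1 - 4 * a)"
        using PX' unfolding d D_def by (simp add: algebra_simps)
    qed (use a w in \<open>auto simp: D_def\<close>)
    finally show ?thesis by simp
  next
    case 3
    \<comment> \<open>Splitting \<open>P\<close> this way makes the coefficient of \<open>q\<close> vanish.\<close>
    have "P * G = X * G + (P - X) * G" by (simp add: algebra_simps)
    also have "\<dots> \<le> X * (2 * (a * b - q)) + (P - X) * (a * b)"
      using 3 G by (intro add_mono mult_left_mono) auto
    finally have "?B \<le> a ^ 5 + 4 * a ^ 3 * x + 3 * a * x\<^sup>2 - D * x\<^sup>2 + x ^ 3 / a + a * X * b + P * (a * b)"
      unfolding B by (simp add: algebra_simps)
    also have "\<dots> = a ^ 5 + a ^ 3 * (4 * x + b) + 3 * a * x\<^sup>2 + 2 * a * x * b + a * b\<^sup>2 + x ^ 3 / a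
        + D * x * (b - x)" (is "_ = ?K")
      unfolding aX P_def by (simp add: algebra_simps power2_eq_square power3_eq_cube)
    finally have BK: "?B \<le> ?K" .
    \<comment> \<open>For \<open>a >= 1/8\<close> one has \<open>D <= 7 a\<close>, hence
      \<open>u <= 7\<close>, and the clique value suffices. For smaller \<open>a\<close> the star
      value is used as well.\<close>
    have "?K \<le> max (star_value c) (sqrt (c ^ 5))"
    proof (cases "a \<ge> 1/8")
      case True
      define v where "v = (b - x) / (2 * a\<^sup>2)"
      have v: "0 \<le> v" "x = a\<^sup>2 * (u - v)" "b = a\<^sup>2 * (u + v)"
        using x a by (auto simp: v_def u_def w_def field_simps)
      have uv: "v \<le> u" using x(1) a v(2) by (simp add: zero_le_mult_iff)
      have u7: "u \<le> 7"
      proof -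
        have "a * u \<le> a * 7" using au True unfolding D_def by linarith
        then show ?thesis using a by (simp only: mult_le_cancel_left_pos)
      qed
      have "D * (x * (b - x)) \<le> 7 * a * (x * (b - x))"
        using True x by (intro mult_right_mono) (auto simp: D_def)
      moreover have "x ^ 3 / a = a ^ 5 * (u - v) ^ 3"
      proof -
        have "x ^ 3 = a * (a ^ 5 * (u - v) ^ 3)" unfolding v by algebra
        then show ?thesis using a by simp
      qed
      ultimately have "?K \<le> a ^ 5 + a ^ 3 * (4 * x + b) + 3 * a * x\<^sup>2 + 2 * a * x * b + a * b\<^sup>2
        + a ^ 5 * (u - v) ^ 3 + 7 * a * (x * (b - x))" by (simp add: mult.assoc)
      also have "a ^ 5 + a ^ 3 * (4 * x + b) + 3 * a * x\<^sup>2 + 2 * a * x * b + a * b\<^sup>2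
          + a ^ 5 * (u - v) ^ 3 + 7 * a * (x * (b - x))
        = a ^ 5 * (1 + 5 * u + 6 * u\<^sup>2 + (u - v) ^ 3 + v * (10 * u - 3 - 12 * v))"
        unfolding v by algebra
      also have "\<dots> \<le> sqrt (c ^ 5)"
      proof (cases "u \<le> 3/10")
        case True
        have "(u - v) ^ 3 \<le> u ^ 3" using uv v by (intro power_mono) auto
        moreover have "v * (10 * u - 3 - 12 * v) \<le> 0"
          using True v by (intro mult_nonneg_nonpos) auto
        ultimately have "a ^ 5 * (1 + 5 * u + 6 * u\<^sup>2 + (u - v) ^ 3 + v * (10 * u - 3 - 12 * v))
          \<le> a ^ 5 * (1 + 5 * u + 6 * u\<^sup>2 + u ^ 3)"
          using a by (intro mult_left_mono) auto
        also have "\<dots> \<le> sqrt (c ^ 5)"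
        proof (rule clique[OF refl])
          have "(1 + 2 * u) ^ 5 - (1 + 5 * u + 6 * u\<^sup>2 + u ^ 3)\<^sup>2
             = 3 * u\<^sup>2 + 18 * u ^ 3 + 34 * u ^ 4 + 19 * u ^ 5 + u ^ 5 * (1 - u)"
            by algebra
          moreover have "\<dots> \<ge> 0" using u True by simp
          ultimately show "(1 + 5 * u + 6 * u\<^sup>2 + u ^ 3)\<^sup>2 \<le> (1 + 2 * u) ^ 5" by linarith
        qed
        finally show ?thesis .
      next
        case False
        \<comment> \<open>\<open>n\<close> arises by inserting the maximum of
          \<open>v (10 u - 3 - 12 v)\<close> over \<open>v\<close>, which is
          \<open>(10 u - 3)^2 / 48\<close> at \<open>v = (10 u - 3) / 24\<close>.\<close>
        define n where "n = (57 + 180 * u + 388 * u\<^sup>2 + 48 * u ^ 3) / 48"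
        have "(u - v) ^ 3 \<le> u ^ 3" using uv v by (intro power_mono) auto
        moreover have "v * (10 * u - 3 - 12 * v) \<le> (10 * u - 3)\<^sup>2 / 48"
          using zero_le_power2[of "10 * u - 3 - 24 * v"]
          by (simp add: power2_eq_square algebra_simps)
        ultimately have "a ^ 5 * (1 + 5 * u + 6 * u\<^sup>2 + (u - v) ^ 3 + v * (10 * u - 3 - 12 * v))
          \<le> a ^ 5 * n"
          using a by (intro mult_left_mono) (auto simp: n_def power2_eq_square field_simps)
        also have "\<dots> \<le> sqrt (c ^ 5)"
        proof (rule clique[OF refl])
          have "2304 * ((1 + 2 * u) ^ 5 - n\<^sup>2) = (2520 * u + 15528 * u\<^sup>2 - 945)
            + 39168 * u ^ 3 + 16496 * u ^ 4 + 20352 * u ^ 5 + 2304 * u ^ 5 * (7 - u)"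
            unfolding n_def by (simp add: power2_eq_square power3_eq_cube field_simps eval_nat_numeral)
          moreover have "u\<^sup>2 \<ge> (3/10)\<^sup>2" using False by (intro power_mono) auto
          then have "2520 * u + 15528 * u\<^sup>2 - 945 \<ge> 0" using False by (simp add: power2_eq_square)
          moreover have "39168 * u ^ 3 + 16496 * u ^ 4 + 20352 * u ^ 5 + 2304 * u ^ 5 * (7 - u) \<ge> 0"
            using u u7 by simp
          ultimately have "0 \<le> 2304 * ((1 + 2 * u) ^ 5 - n\<^sup>2)" by (simp only: add.assoc add_nonneg_nonneg)
          then show "n\<^sup>2 \<le> (1 + 2 * u) ^ 5" by simp
        qed
        finally show ?thesis .
      qed
      finally show ?thesis by simp
    next
      case False
      have a8: "a \<le> 1/8" using False by simp
      define E where "E = a ^ 5 * (1 + 8 * u + 8 * u\<^sup>2 + 4 * (a * u\<^sup>2) + 8/3 * (a * u ^ 3))"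
      have "a * X \<le> a * P" using 3 a by simp
      then have XP: "D * x \<le> 3 * a ^ 3 + 2 * a * x + a * b"
        unfolding aX by (simp add: P_def power2_eq_square power3_eq_cube algebra_simps)
      have "D * x * (b - x) \<le> (3 * a ^ 3 + 2 * a * x + a * b) * (b - x)"
        using XP x by (intro mult_right_mono) auto
      then have "?K \<le> a ^ 5 + a ^ 3 * (x + 4 * b) + a * (x\<^sup>2 + 3 * x * b + 2 * b\<^sup>2) + x ^ 3 / a"
        by (simp add: algebra_simps power2_eq_square)
      also have "\<dots> \<le> a ^ 5 + a ^ 3 * (8 * w) + a * (8 * w\<^sup>2) + w\<^sup>2 * (4 * a\<^sup>2 + 8/3 * w)"
      proof -
        have "a ^ 3 * (x + 4 * b) \<le> a ^ 3 * (8 * w)"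
          using a x by (intro mult_left_mono) (auto simp: w_def)
        moreover have "a * (x\<^sup>2 + 3 * x * b + 2 * b\<^sup>2) \<le> a * (8 * w\<^sup>2)"
        proof -
          have "0 \<le> x * (x + b)" using x by simp
          then show ?thesis
            using a by (intro mult_left_mono) (auto simp: w_def power2_eq_square field_simps)
        qed
        moreover have "x ^ 3 / a \<le> w\<^sup>2 * (4 * a\<^sup>2 + 8/3 * w)"
        proof -
          have "x * a * 2 \<le> x * (1/8) * 2" using a8 x by (intro mult_right_mono mult_left_mono) auto
          moreover have "x * (1 - 2 * a) \<le> 3 * a ^ 3 + 2 * a * w"
            using XP by (simp add: D_def w_def field_simps)
          ultimately have "3/4 * x \<le> a * (3 * a\<^sup>2 + 2 * w)"
            by (simp add: algebra_simps power2_eq_square power3_eq_cube)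
          then have "x / a \<le> 4 * a\<^sup>2 + 8/3 * w" using a by (simp add: field_simps)
          then have "x\<^sup>2 * (x / a) \<le> w\<^sup>2 * (4 * a\<^sup>2 + 8/3 * w)"
            using xx x a by (intro mult_mono) auto
          then show ?thesis by (simp add: power2_eq_square power3_eq_cube)
        qed
        ultimately show ?thesis by linarith
      qed
      also have "\<dots> = E" unfolding E_def u by algebra
      finally have KE: "?K \<le> E" .
      have au2: "a * u\<^sup>2 \<le> 1/8 * u\<^sup>2" using a8 by (intro mult_right_mono) auto
      have au3: "a * u ^ 3 \<le> 1/8 * u ^ 3" using a8 u by (intro mult_right_mono) auto
      have n8: "E \<le> a ^ 5 * (1 + 8 * u + 17/2 * u\<^sup>2 + u ^ 3 / 3)" (is "_ \<le> _ * ?n")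
        unfolding E_def using au2 au3 a by (intro mult_left_mono) auto
      \<comment> \<open>The cubic lower bound for the star value serves for \<open>u <= 2\<close>.
        Beyond that the clique value does: up to \<open>u = 8\<close> with \<open>n8\<close>, and
        from there on with \<open>a u <= 1\<close>, which lowers the degree of \<open>E\<close> in
        \<open>u\<close> by one.\<close>
      consider "u \<le> 2" | "2 \<le> u" "u \<le> 8" | "8 \<le> u" by linarith
      then have "E \<le> max (star_value c) (sqrt (c ^ 5))"
      proof cases
        case 1
        define v where "v = 1 + 2 * u"
        have v: "1 \<le> v" "v \<le> 5" using u 1 by (auto simp: v_def)
        have "4 * (a * ?n) \<le> v\<^sup>2 * (1 + 2 * (a\<^sup>2 * v))"
        proof -
          \<comment> \<open>Here \<open>a^2\<close> is replaced by its tangent at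
            \<open>a = 1/8\<close>. The claim becomes linear in \<open>a\<close> and follows from
            the endpoints \<open>a = 0\<close> and \<open>a = 1/8\<close>.\<close>
          have t: "v ^ 3 * (2 * a\<^sup>2) \<ge> v ^ 3 * (a / 2 - 1/32)"
            using v zero_le_power2[of "a - 1/8"]
            by (intro mult_left_mono) (auto simp: power2_eq_square algebra_simps)
          define n where "n = ?n"
          have "v\<^sup>2 + v ^ 3 / 32 - n / 2 = 17/32 + 3/16 * u + 1/8 * u\<^sup>2 + 1/12 * u ^ 3"
            by (simp add: n_def v_def power2_eq_square power3_eq_cube field_simps)
          moreover have "\<dots> \<ge> 0" using u by simp
          ultimately have "n / 2 \<le> v\<^sup>2 + v ^ 3 / 32" by linarith
          then have "(8 * a) * (n / 2) \<le> (8 * a) * (v\<^sup>2 + v ^ 3 / 32)"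
            using a by (intro mult_left_mono) auto
          moreover have "(1 - 8 * a) * (v\<^sup>2 * (1 - v / 32)) \<ge> 0"
            using a8 v by (intro mult_nonneg_nonneg) auto
          moreover have "v\<^sup>2 * (1 + 2 * (a\<^sup>2 * v)) - 4 * (a * n)
            = (v ^ 3 * (2 * a\<^sup>2) - v ^ 3 * (a / 2 - 1/32)) + (8 * a * (v\<^sup>2 + v ^ 3 / 32) - 8 * a * (n / 2))
              + (1 - 8 * a) * (v\<^sup>2 * (1 - v / 32))"
            by (simp add: power2_eq_square power3_eq_cube field_simps)
          ultimately show ?thesis using t unfolding n_def by linarith
        qed
        then have "a ^ 4 / 4 * (4 * (a * ?n)) \<le> a ^ 4 / 4 * (v\<^sup>2 * (1 + 2 * (a\<^sup>2 * v)))"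
          by (intro mult_left_mono) auto
        also have "\<dots> = c\<^sup>2 / 4 * (1 + 2 * c)"
          unfolding cu v_def by algebra
        also have "\<dots> \<le> star_value c" using c01 by (rule star_value_ge)
        finally have "a ^ 5 * ?n \<le> star_value c" by (simp add: eval_nat_numeral mult.assoc)
        with n8 show ?thesis by simp
      next
        case 2
        have "a ^ 5 * ?n \<le> sqrt (c ^ 5)"
        proof (rule clique[OF refl])
          have eq: "36 * ((1 + 2 * u) ^ 5 - ?n\<^sup>2)
             = u ^ 5 * (4 * (8 - u)) + 87 * u ^ 4 + 916 * u ^ 5 - 2040 * u ^ 3 - 1476 * u\<^sup>2 - 216 * u"
            by (simp add: power2_eq_square power3_eq_cube field_simps eval_nat_numeral)
        have "u ^ 5 * (4 * (8 - u)) \<ge> 0" using u 2 by simp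
          moreover have "u\<^sup>2 \<ge> 2 * u" using 2 by (simp add: power2_eq_square mult_right_mono)
          moreover have "u ^ 3 \<ge> 2 * u\<^sup>2" using 2 by (simp add: power2_eq_square power3_eq_cube mult_right_mono)
          moreover have "u ^ 4 \<ge> 2 * u ^ 3" using 2 by (simp add: eval_nat_numeral mult_right_mono)
          moreover have "u ^ 5 \<ge> 2 * u ^ 4" using 2 by (simp add: eval_nat_numeral mult_right_mono)
          ultimately have "0 \<le> 36 * ((1 + 2 * u) ^ 5 - ?n\<^sup>2)" using u(1) unfolding eq by linarith
          then show "?n\<^sup>2 \<le> (1 + 2 * u) ^ 5" by simp
        qed
        with n8 show ?thesis by simp
      next
        case 3
        have "a * u \<le> 1" using au D by linarith
        then have "a * u\<^sup>2 \<le> u" "a * u ^ 3 \<le> u\<^sup>2"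
          using mult_right_mono[of "a * u" 1 u] mult_right_mono[of "a * u" 1 "u\<^sup>2"] u
          by (auto simp: power2_eq_square power3_eq_cube mult.assoc)
        then have "E \<le> a ^ 5 * (1 + 12 * u + 32/3 * u\<^sup>2)"
          unfolding E_def using a by (intro mult_left_mono) auto
        also have "\<dots> \<le> sqrt (c ^ 5)"
        proof (rule clique[OF refl])
          have eq: "9 * ((1 + 2 * u) ^ 5 - (1 + 12 * u + 32/3 * u\<^sup>2)\<^sup>2)
            = 288 * u ^ 5 - 304 * u ^ 4 - 1584 * u ^ 3 - 1128 * u\<^sup>2 - 126 * u"
            by (simp add: power2_eq_square power3_eq_cube field_simps eval_nat_numeral)
          have "u\<^sup>2 \<ge> 8 * u" using 3 by (simp add: power2_eq_square mult_right_mono)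
          moreover have "u ^ 3 \<ge> 8 * u\<^sup>2" using 3 by (simp add: power2_eq_square power3_eq_cube mult_right_mono)
          moreover have "u ^ 4 \<ge> 8 * u ^ 3" using 3 by (simp add: eval_nat_numeral mult_right_mono)
          moreover have "u ^ 5 \<ge> 8 * u ^ 4" using 3 by (simp add: eval_nat_numeral mult_right_mono)
          ultimately have "0 \<le> 9 * ((1 + 2 * u) ^ 5 - (1 + 12 * u + 32/3 * u\<^sup>2)\<^sup>2)"
            using u(1) unfolding eq by linarith
          then show "(1 + 12 * u + 32/3 * u\<^sup>2)\<^sup>2 \<le> (1 + 2 * u) ^ 5" by simp
        qed
        finally show ?thesis by simp
      qed
      with KE show ?thesis by linarith
    qed
    with BK show ?thesis by linarith
  qed
qed

subsection \<open>Nonincreasing degree functions\<close>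

text \<open>Meant for comparisons of \<open>l\<close> with \<open>a\<close> on one side of the
  crossing point, where nothing is known at \<open>a\<close> itself.\<close>

lemma integral_le_off_finite:
  fixes f g :: "real \<Rightarrow> real"
  assumes "finite Z" "f integrable_on {s..t}" "g integrable_on {s..t}"
    and "\<And>x. x \<in> {s..t} - Z \<Longrightarrow> f x \<le> g x"
  shows "integral {s..t} f \<le> integral {s..t} g"
proof -
  let ?f = "\<lambda>x. if x \<in> Z then 0 else f x" and ?g = "\<lambda>x. if x \<in> Z then 0 else g x"
  have Z: "negligible Z" using assms by auto
  have "?f integrable_on {s..t}" "?g integrable_on {s..t}"
    by (rule integrable_spike[OF assms(2) Z], simp) (rule integrable_spike[OF assms(3) Z], simp)
  then have "integral {s..t} ?f \<le> integral {s..t} ?g"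
    using assms by (intro integral_le) auto
  moreover have "integral {s..t} ?f = integral {s..t} f" "integral {s..t} ?g = integral {s..t} g"
    by (rule integral_spike[OF Z], simp)+
  ultimately show ?thesis by simp
qed

lemma integrable_on_bounded_measurable:
  fixes f :: "real \<Rightarrow> real"
  assumes "f \<in> borel_measurable (lebesgue_on {s..t})" "\<And>x. x \<in> {s..t} \<Longrightarrow> \<bar>f x\<bar> \<le> B"
  shows "f integrable_on {s..t}"
  by (rule measurable_bounded_by_integrable_imp_integrable[OF assms(1), where g = "\<lambda>_. B"])
    (use assms(2) in auto)

text \<open>\<open>degree_mass\<close> and \<open>degree_moment\<close> are all that is retained of
  the kernel; at the crossing point they become \<open>x <= b\<close> and
  \<open>q + G / 2 <= a b\<close>. Continuity off a finite set is satisfied by step functions and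
  lets primitives be differentiated there.\<close>

locale sorted_degree =
  fixes l :: "real \<Rightarrow> real" and Z :: "real set"
  assumes finite_Z: "finite Z"
    and isCont_l: "\<And>x. x \<in> {0<..<1} - Z \<Longrightarrow> isCont l x"
    and l_anti: "\<And>x y. 0 \<le> x \<Longrightarrow> x \<le> y \<Longrightarrow> y \<le> 1 \<Longrightarrow> l y \<le> l x"
    and l_nonneg: "\<And>x. 0 \<le> x \<Longrightarrow> x \<le> 1 \<Longrightarrow> 0 \<le> l x"
    and l_le_1: "\<And>x. 0 \<le> x \<Longrightarrow> x \<le> 1 \<Longrightarrow> l x \<le> 1"
    and degree_mass: "\<And>a. 0 \<le> a \<Longrightarrow> a \<le> 1 \<Longrightarrow>
      integral {0..a} l \<le> integral {0..1} (\<lambda>y. min a (l y))"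
    and degree_moment: "\<And>a. 0 \<le> a \<Longrightarrow> a \<le> 1 \<Longrightarrow>
      integral {0..a} (\<lambda>x. (a - x) * l x)
        \<le> integral {0..1} (\<lambda>y. a * min a (l y) - (min a (l y))\<^sup>2 / 2)"
begin

section \<open>The primitive \<open>L\<close> of the degree function and its calculus\<close>

definition L :: "real \<Rightarrow> real" where "L x = integral {0..x} l"

lemma measurable_l: "l \<in> borel_measurable (lebesgue_on {0..1})"
proof -
  have "mono_on {0..1} (\<lambda>x. - l x)" using l_anti by (auto simp: mono_on_def)
  then have "(\<lambda>x. - l x) \<in> borel_measurable (lebesgue_on {0..1})"
    using integrable_mono_on by blast
  then show ?thesis by simp
qed

lemma integrable_l01: "l integrable_on {0..1}"
  using measurable_l l_nonneg l_le_1
  by (intro integrable_on_bounded_measurable[where B = 1]) (auto simp: abs_le_iff intro: order_trans[of _ 0])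

lemma integrable_l: "0 \<le> s \<Longrightarrow> t \<le> 1 \<Longrightarrow> l integrable_on {s..t}"
  by (rule integrable_subinterval_real[OF integrable_l01]) auto

lemma L_0 [simp]: "L 0 = 0" by (simp add: L_def)

lemma integral_l: "0 \<le> s \<Longrightarrow> s \<le> t \<Longrightarrow> t \<le> 1 \<Longrightarrow> integral {s..t} l = L t - L s"
  using Henstock_Kurzweil_Integration.integral_combine[of 0 s t l] integrable_l[of 0 t]
  by (simp add: L_def)

lemma L_diff_bounds:
  assumes "0 \<le> s" "s \<le> t" "t \<le> 1"
  shows "(t - s) * l t \<le> L t - L s" "L t - L s \<le> (t - s) * l s"
proof -
  have "integral {s..t} (\<lambda>_. l t) \<le> integral {s..t} l"
    using assms l_anti by (intro integral_le integrable_l) auto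
  then show "(t - s) * l t \<le> L t - L s" using assms by (simp add: integral_l)
  have "integral {s..t} l \<le> integral {s..t} (\<lambda>_. l s)"
    using assms l_anti by (intro integral_le integrable_l) auto
  then show "L t - L s \<le> (t - s) * l s" using assms by (simp add: integral_l)
qed

lemma L_mono: "0 \<le> s \<Longrightarrow> s \<le> t \<Longrightarrow> t \<le> 1 \<Longrightarrow> L s \<le> L t"
  using L_diff_bounds(1)[of s t] l_nonneg[of t] mult_nonneg_nonneg[of "t - s" "l t"] by linarith

lemma L_nonneg: "0 \<le> t \<Longrightarrow> t \<le> 1 \<Longrightarrow> 0 \<le> L t"
  using L_mono[of 0 t] by simp

lemma L_le: "0 \<le> t \<Longrightarrow> t \<le> 1 \<Longrightarrow> L t \<le> t"
  using L_diff_bounds(2)[of 0 t] l_le_1[of 0] mult_left_mono[of "l 0" 1 t] by simp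

text \<open>The mean of \<open>l\<close> over \<open>[0,x]\<close> is at least \<open>l x\<close>,
  the mean over \<open>[x,a]\<close> at most \<open>l x\<close>; the statement is this with
  denominators cleared.\<close>

lemma L_concave: "0 \<le> x \<Longrightarrow> x \<le> a \<Longrightarrow> a \<le> 1 \<Longrightarrow> x * L a \<le> a * L x"
  using L_diff_bounds(1)[of 0 x] L_diff_bounds(2)[of x a]
    mult_left_mono[of "x * l x" "L x" "a - x"] mult_left_mono[of "L a - L x" "(a - x) * l x" x]
  by (simp add: algebra_simps)

lemma continuous_on_L: "0 \<le> s \<Longrightarrow> t \<le> 1 \<Longrightarrow> continuous_on {s..t} L"
  unfolding L_def
  by (rule continuous_on_subset[OF indefinite_integral_continuous_1[OF integrable_l01]]) auto

lemma antiderivative: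
  assumes "f integrable_on {0..1}" "x \<in> {0<..<1}" "isCont f x"
  shows "((\<lambda>u. integral {0..u} f) has_real_derivative f x) (at x)"
proof -
  have "((\<lambda>u. integral {0..u} f) has_vector_derivative f x) (at x within ({0..1} - {}))"
    using assms by (intro integral_has_vector_derivative_continuous_at)
      (auto intro: continuous_at_imp_continuous_within)
  moreover have "at x within {0..1} = at x"
    using assms by (intro at_within_Icc_at) auto
  ultimately show ?thesis by (simp add: has_real_derivative_iff_has_vector_derivative)
qed

lemma DERIV_L: "x \<in> {0<..<1} - Z \<Longrightarrow> (L has_real_derivative l x) (at x)"
  using antiderivative[OF integrable_l01, of x] isCont_l[of x] by (simp add: L_def[abs_def])

text \<open>Primitives of functions with jumps are differentiable only off \<open>Z\<close>;
  continuity bridges the finitely many exceptions.\<close>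

lemma ftc:
  assumes "0 \<le> s" "s \<le> t" "t \<le> 1" "continuous_on {s..t} F"
    and "\<And>x. x \<in> {0<..<1} - Z \<Longrightarrow> (F has_real_derivative f x) (at x)"
  shows "(f has_integral F t - F s) {s..t}"
  using assms finite_Z
  by (intro fundamental_theorem_of_calculus_interior_strong)
    (auto simp flip: has_real_derivative_iff_has_vector_derivative)

lemma measurable_L: "L \<in> borel_measurable (lebesgue_on {0..1})"
  using continuous_on_L[of 0 1] by (intro continuous_imp_measurable_on_sets_lebesgue) auto

lemma integrable_sq: "0 \<le> s \<Longrightarrow> t \<le> 1 \<Longrightarrow> (\<lambda>x. (l x)\<^sup>2) integrable_on {s..t}"
proof (rule integrable_subinterval_real)
  show "(\<lambda>x. (l x)\<^sup>2) integrable_on {0..1}"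
    using measurable_l l_nonneg l_le_1
    by (intro integrable_on_bounded_measurable[where B = 1]) (auto simp: power_le_one)
qed auto

lemma integrable_L_sq: "0 \<le> s \<Longrightarrow> t \<le> 1 \<Longrightarrow> (\<lambda>x. L x * (l x)\<^sup>2) integrable_on {s..t}"
proof (rule integrable_subinterval_real)
  show "(\<lambda>x. L x * (l x)\<^sup>2) integrable_on {0..1}"
  proof (rule integrable_on_bounded_measurable[where B = 1])
    show "\<bar>L x * (l x)\<^sup>2\<bar> \<le> 1" if "x \<in> {0..1}" for x
      using that l_nonneg[of x] l_le_1[of x] L_nonneg[of x] L_le[of x]
      by (simp add: abs_mult mult_le_one power_le_one)
  qed (use measurable_l measurable_L in measurable)
qed auto

section \<open>The energy as a single integral, and the cut at the diagonal\<close>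

text \<open>The minimum is \<open>l y\<close> for \<open>x <= y\<close> and \<open>l x\<close> for
  \<open>x >= y\<close>, so the inner integral is \<open>L y * (l y)^2 + l y * R y\<close>, where
  \<open>R\<close> is the tail integral of \<open>l^2\<close>. Integration by parts shows that the
  two summands contribute equally.\<close>

lemma energy_eq:
  "integral {0..1} (\<lambda>y. integral {0..1} (\<lambda>x. l x * l y * min (l x) (l y)))
    = 2 * integral {0..1} (\<lambda>x. L x * (l x)\<^sup>2)"
proof -
  define R where "R y = integral {0..1} (\<lambda>x. (l x)\<^sup>2) - integral {0..y} (\<lambda>x. (l x)\<^sup>2)" for y
  have inner: "integral {0..1} (\<lambda>x. l x * l y * min (l x) (l y)) = L y * (l y)\<^sup>2 + l y * R y"
    if y: "y \<in> {0..1}" for y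
  proof -
    have "((\<lambda>x. l x * (l y)\<^sup>2) has_integral L y * (l y)\<^sup>2) {0..y}"
      using integrable_l[of 0 y] y unfolding L_def by (intro has_integral_mult_left) auto
    then have 1: "((\<lambda>x. l x * l y * min (l x) (l y)) has_integral L y * (l y)\<^sup>2) {0..y}"
      by (rule has_integral_eq[rotated]) (use y l_anti in \<open>auto simp: power2_eq_square min_absorb2\<close>)
    have "((\<lambda>x. (l x)\<^sup>2) has_integral R y) {y..1}"
      using y Henstock_Kurzweil_Integration.integral_combine[of 0 y 1 "\<lambda>x. (l x)\<^sup>2", symmetric]
        integrable_sq[of 0 1] integrable_integral[OF integrable_sq[of y 1]]
      by (simp add: R_def)
    then have "((\<lambda>x. l y * (l x)\<^sup>2) has_integral l y * R y) {y..1}"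
      by (rule has_integral_mult_right)
    then have 2: "((\<lambda>x. l x * l y * min (l x) (l y)) has_integral l y * R y) {y..1}"
      by (rule has_integral_eq[rotated]) (use y l_anti in \<open>auto simp: power2_eq_square min_absorb1\<close>)
    show ?thesis
      using has_integral_combine[OF _ _ 1 2] y by (intro integral_unique) auto
  qed
  \<comment> \<open>The integrand is the derivative of \<open>L * R\<close>, which vanishes at both
    ends because \<open>L 0 = 0\<close> and \<open>R 1 = 0\<close>.\<close>
  have "((\<lambda>x. l x * R x - L x * (l x)\<^sup>2) has_integral L 1 * R 1 - L 0 * R 0) {0..1}"
  proof (rule ftc)
    have "continuous_on {0..1} R"
      unfolding R_def by (intro continuous_intros indefinite_integral_continuous_1 integrable_sq) auto
    then show "continuous_on {0..1} (\<lambda>x. L x * R x)"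
      by (intro continuous_intros continuous_on_L) auto
    show "((\<lambda>x. L x * R x) has_real_derivative l x * R x - L x * (l x)\<^sup>2) (at x)"
      if x: "x \<in> {0<..<1} - Z" for x
    proof -
      have "isCont (\<lambda>x. (l x)\<^sup>2) x" using isCont_l[OF x] by (intro continuous_intros)
      then have "((\<lambda>u. integral {0..u} (\<lambda>x. (l x)\<^sup>2)) has_real_derivative (l x)\<^sup>2) (at x)"
        using x integrable_sq[of 0 1] by (intro antiderivative) auto
      then have "(R has_real_derivative - (l x)\<^sup>2) (at x)"
        unfolding R_def by (auto intro!: derivative_eq_intros)
      then show ?thesis
        using DERIV_L[OF x] by (auto intro!: derivative_eq_intros)
    qed
  qed auto
  then have "((\<lambda>x. l x * R x - L x * (l x)\<^sup>2) has_integral 0) {0..1}"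
    by (simp add: R_def)
  from has_integral_add[OF this integrable_integral[OF integrable_L_sq[of 0 1]]]
  have lR: "((\<lambda>x. l x * R x) has_integral integral {0..1} (\<lambda>x. L x * (l x)\<^sup>2)) {0..1}" by simp
  have "integral {0..1} (\<lambda>y. integral {0..1} (\<lambda>x. l x * l y * min (l x) (l y)))
      = integral {0..1} (\<lambda>y. L y * (l y)\<^sup>2 + l y * R y)"
    using inner by (intro integral_cong) auto
  also have "\<dots> = 2 * integral {0..1} (\<lambda>x. L x * (l x)\<^sup>2)"
    using has_integral_add[OF integrable_integral[OF integrable_L_sq[of 0 1]] lR]
    by (intro integral_unique) simp
  finally show ?thesis .
qed

text \<open>\<open>a\<close> is the supremum of the points where \<open>l\<close> lies on or above
  the diagonal. Since \<open>l\<close> may jump across the diagonal there, nothing is claimed about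
  \<open>l a\<close>.\<close>

lemma crossing:
  obtains a where "0 \<le> a" "a \<le> 1" "\<And>x. 0 \<le> x \<Longrightarrow> x < a \<Longrightarrow> a \<le> l x"
    "\<And>x. a < x \<Longrightarrow> x \<le> 1 \<Longrightarrow> l x \<le> a"
proof -
  define X where "X = {x. 0 \<le> x \<and> x \<le> 1 \<and> x \<le> l x}"
  have X0: "0 \<in> X" using l_nonneg by (auto simp: X_def)
  have bdd: "bdd_above X" by (rule bdd_aboveI[of _ 1]) (auto simp: X_def)
  show ?thesis
  proof (rule that[of "Sup X"])
    show "0 \<le> Sup X" using X0 bdd by (rule cSup_upper)
    show "Sup X \<le> 1"
    proof (rule cSup_least)
      show "X \<noteq> {}" using X0 by auto
    qed (simp add: X_def)
    show "Sup X \<le> l x" if x: "0 \<le> x" "x < Sup X" for x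
    proof (rule cSup_least)
      \<comment> \<open>A point \<open>z\<close> of \<open>X\<close> beyond \<open>x\<close> lifts
        every \<open>y\<close> in \<open>X\<close> to \<open>max y z\<close>, which is again in
        \<open>X\<close> and lies beyond \<open>x\<close>, so that monotonicity applies.\<close>
      obtain z where z: "z \<in> X" "x < z" using less_cSupD[of X x] x(2) X0 by blast
      fix y assume "y \<in> X"
      then have "max y z \<in> X" "x < max y z" using z by (auto simp: max_def)
      then have "max y z \<le> l x" using l_anti[of x "max y z"] x(1) by (auto simp: X_def)
      then show "y \<le> l x" by simp
    qed (use X0 in auto)
    show "l x \<le> Sup X" if "Sup X < x" "x \<le> 1" for x
    proof (rule dense_ge_bounded[OF that(1)])
      fix y assume y: "Sup X < y" "y < x"
      have "y \<notin> X" using y bdd cSup_upper[of y X] by auto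
      moreover have "0 \<le> y" using y \<open>0 \<le> Sup X\<close> by linarith
      ultimately have "l y < y" using y that by (auto simp: X_def)
      then show "l x \<le> y" using l_anti[of y x] y that \<open>0 \<le> y\<close> by linarith
    qed
  qed
qed

text \<open>Let \<open>N x\<close> be the integral of \<open>l\<close> over \<open>[x,1]\<close>.
  The difference of the sides is the integral of \<open>l^2 * (2 N - N a)\<close> over
  \<open>[a,1]\<close>, while \<open>l * (2 N - N a)\<close> integrates to zero there. As
  \<open>l\<close> and \<open>N\<close> decrease together, this is Chebyshev's inequality.\<close>

lemma tail_bound:
  assumes a: "0 \<le> a" "a \<le> 1"
  shows "2 * integral {a..1} (\<lambda>x. L x * (l x)\<^sup>2)
    \<le> (2 * L 1 - (L 1 - L a)) * integral {a..1} (\<lambda>x. (l x)\<^sup>2)"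
proof -
  define N where "N x = L 1 - L x" for x
  \<comment> \<open>The point \<open>z\<close> halves the mass of \<open>[a,1]\<close>; the minus
    sign gives the values the order that \<open>IVT'\<close> expects.\<close>
  have "\<exists>z\<ge>a. z \<le> 1 \<and> - N z = - (N a / 2)"
    using a L_mono[of a 1] unfolding N_def
    by (intro IVT' continuous_intros continuous_on_L) (auto simp: field_simps)
  then obtain z where z: "a \<le> z" "z \<le> 1" "N z = N a / 2" by auto
  \<comment> \<open>\<open>2 N - N a\<close> changes sign at \<open>z\<close> and \<open>l\<close> decreases, so one factor \<open>l\<close> may be replaced by \<open>l z\<close>;
    then the integrand is an exact derivative.\<close>
  define k where "k = l z"
  have 0: "((\<lambda>x. k * (l x * (2 * N x - N a))) has_integral
      k * (N a * N 1 - (N 1)\<^sup>2) - k * (N a * N a - (N a)\<^sup>2)) {a..1}"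
  proof (rule ftc)
    show "continuous_on {a..1} (\<lambda>x. k * (N a * N x - (N x)\<^sup>2))"
      unfolding N_def using a by (intro continuous_intros continuous_on_L) auto
    show "((\<lambda>x. k * (N a * N x - (N x)\<^sup>2)) has_real_derivative k * (l x * (2 * N x - N a))) (at x)"
      if x: "x \<in> {0<..<1} - Z" for x
      unfolding N_def using DERIV_L[OF x] by (auto intro!: derivative_eq_intros simp: algebra_simps)
  qed (use a in auto)
  then have 1: "((\<lambda>x. k * (l x * (2 * N x - N a))) has_integral 0) {a..1}"
    by (simp add: N_def power2_eq_square)
  have 2: "((\<lambda>x. (2 * L 1 - N a) * (l x)\<^sup>2 - 2 * (L x * (l x)\<^sup>2)) has_integral
     (2 * L 1 - N a) * integral {a..1} (\<lambda>x. (l x)\<^sup>2) - 2 * integral {a..1} (\<lambda>x. L x * (l x)\<^sup>2)) {a..1}"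
    using a by (intro has_integral_diff has_integral_mult_right integrable_integral integrable_sq integrable_L_sq) auto
  have "0 \<le> (2 * L 1 - N a) * integral {a..1} (\<lambda>x. (l x)\<^sup>2) - 2 * integral {a..1} (\<lambda>x. L x * (l x)\<^sup>2)"
  proof (rule has_integral_le[OF 1 2])
    fix x assume x: "x \<in> {a..1}"
    have "0 \<le> (l x - k) * (2 * N x - N a)"
    proof (cases "x \<le> z")
      case True
      then have "k \<le> l x" "N a \<le> 2 * N x"
        using l_anti[of x z] L_mono[of x z] x a z by (auto simp: k_def N_def)
      then show ?thesis by simp
    next
      case False
      then have "l x \<le> k" "2 * N x \<le> N a"
        using l_anti[of z x] L_mono[of z x] x a z by (auto simp: k_def N_def)
      then show ?thesis by (simp add: mult_nonpos_nonpos)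
    qed
    then have "0 \<le> l x * ((l x - k) * (2 * N x - N a))" using l_nonneg[of x] x a by simp
    moreover have "(2 * L 1 - N a) * (l x)\<^sup>2 - 2 * (L x * (l x)\<^sup>2) = l x * (l x * (2 * N x - N a))"
      by (simp add: N_def power2_eq_square algebra_simps)
    ultimately show "k * (l x * (2 * N x - N a)) \<le> (2 * L 1 - N a) * (l x)\<^sup>2 - 2 * (L x * (l x)\<^sup>2)"
      by (simp add: algebra_simps)
  qed
  then show ?thesis by (simp add: N_def)
qed

text \<open>The truncation \<open>min a (l y)\<close> is \<open>a\<close> before the crossing point
  and \<open>l y\<close> after it. This evaluates the right-hand sides of \<open>degree_mass\<close>
  and \<open>degree_moment\<close>.\<close>

lemma integral_min_crossing:
  assumes a: "0 \<le> a" "a \<le> 1" and ge: "\<And>x. 0 \<le> x \<Longrightarrow> x < a \<Longrightarrow> a \<le> l x"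
    and le: "\<And>x. a < x \<Longrightarrow> x \<le> 1 \<Longrightarrow> l x \<le> a"
    and h: "(\<lambda>y. h (l y)) integrable_on {a..1}"
  shows "integral {0..1} (\<lambda>y. h (min a (l y))) = a * h a + integral {a..1} (\<lambda>y. h (l y))"
proof -
  have "((\<lambda>y. h (min a (l y))) has_integral a * h a) {0..a}"
  proof (rule has_integral_spike[of "{a}"])
    show "((\<lambda>y. h a) has_integral a * h a) {0..a}"
      using has_integral_const_real[of "h a" 0 a] a by simp
    show "h (min a (l x)) = h a" if "x \<in> {0..a} - {a}" for x
      using that ge[of x] by (auto simp: min_absorb1)
  qed auto
  moreover have "((\<lambda>y. h (min a (l y))) has_integral integral {a..1} (\<lambda>y. h (l y))) {a..1}"
  proof (rule has_integral_spike[of "{a}"])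
    show "((\<lambda>y. h (l y)) has_integral integral {a..1} (\<lambda>y. h (l y))) {a..1}"
      using h by (rule integrable_integral)
    show "h (min a (l x)) = h (l x)" if "x \<in> {a..1} - {a}" for x
      using that le[of x] by (auto simp: min_absorb2)
  qed auto
  ultimately have "((\<lambda>y. h (min a (l y))) has_integral
      a * h a + integral {a..1} (\<lambda>y. h (l y))) {0..1}"
    using a by (intro has_integral_combine[of 0 a 1]) auto
  then show ?thesis by (rule integral_unique)
qed

section \<open>Estimates on \<open>[0,a]\<close>, to the left of the crossing point\<close>

context
  fixes a :: real
  assumes a: "0 < a" "a < 1" and ge: "\<And>x. 0 \<le> x \<Longrightarrow> x < a \<Longrightarrow> a \<le> l x"
    and le: "\<And>x. a < x \<Longrightarrow> x \<le> 1 \<Longrightarrow> l x \<le> a"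
begin

definition V :: "real \<Rightarrow> real" where "V x = L x - a * x"

lemma continuous_on_V: "continuous_on {0..a} V"
  unfolding V_def using a by (intro continuous_intros continuous_on_L) auto

lemma DERIV_V: "x \<in> {0<..<1} - Z \<Longrightarrow> (V has_real_derivative l x - a) (at x)"
  unfolding V_def using DERIV_L by (auto intro!: derivative_eq_intros)

lemma integrable_V: "V integrable_on {0..a}"
  using continuous_on_V by (rule integrable_continuous_real)

text \<open>Like \<open>L\<close>, the function \<open>V\<close> is concave and vanishes at
  \<open>0\<close>, and its slope \<open>l - a\<close> is nonnegative before \<open>a\<close>; these
  are the tangent bound, the chord bound and monotonicity.\<close>

lemma V_bounds:
  assumes x: "0 \<le> x" "x < a"
  shows "x * (l x - a) \<le> V x" "x * V a \<le> a * V x" "V x \<le> V a" "0 \<le> V x"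
proof -
  show 1: "x * (l x - a) \<le> V x"
    using L_diff_bounds(1)[of 0 x] x a by (simp add: V_def algebra_simps)
  show "x * V a \<le> a * V x"
    using L_concave[of x a] x a by (simp add: V_def algebra_simps)
  have "0 \<le> x * (l x - a)" using ge x by simp
  with 1 show "0 \<le> V x" by linarith
  show "V x \<le> V a"
  proof -
    have "integral {x..a} (\<lambda>_. a) \<le> integral {x..a} l"
      using x a ge by (intro integral_le_off_finite[of "{a}"] integrable_l) auto
    then show ?thesis using x a by (simp add: V_def integral_l algebra_simps)
  qed
qed

lemma V_a_nonneg: "0 \<le> V a"
  using V_bounds(3)[of 0] a by (simp add: V_def)

text \<open>With \<open>l = a + v\<close> and \<open>L = a x + V\<close>, the terms quadratic in
  \<open>v\<close> are made linear by \<open>x v <= V\<close> and by a bound for \<open>V v\<close>.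
  What remains is a combination of the derivatives of \<open>x^2\<close>, \<open>x V\<close> and
  \<open>V^2\<close>, plus a multiple of \<open>V\<close>.\<close>

lemma head_bound:
  defines "w \<equiv> V a"
  shows "2 * integral {0..a} (\<lambda>x. L x * (l x)\<^sup>2)
    \<le> a ^ 5 + 4 * a ^ 3 * w + 3 * a * w\<^sup>2 - (1 - a) * w\<^sup>2 + w ^ 3 / a
      + (2 * (1 - a) * w / a - 2 * a\<^sup>2) * integral {0..a} V"
proof -
  define D where "D = 1 - a"
  define m where "m = w / a"
  have m: "0 \<le> m" "w = m * a" using V_a_nonneg a by (auto simp: m_def w_def)
  \<comment> \<open>The coefficients are read off the pointwise bound below: those of
    \<open>x\<close>, \<open>x v\<close> and \<open>V v\<close> determine \<open>F\<close>, and the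
    term \<open>(2 m D - 2 a^2) V\<close> corrects the coefficient of \<open>V\<close>.\<close>
  define F where "F x = a ^ 3 * x\<^sup>2 + (4 * a\<^sup>2 - 2 * m * D) * (x * V x) + (3 * a + D + m) * (V x)\<^sup>2" for x
  define f where "f x = 2 * a ^ 3 * x + (4 * a\<^sup>2 - 2 * m * D) * (V x + x * (l x - a))
    + 2 * (3 * a + D + m) * (V x * (l x - a))" for x
  have F: "(f has_integral F a - F 0) {0..a}"
  proof (rule ftc)
    show "continuous_on {0..a} F"
      unfolding F_def by (intro continuous_intros continuous_on_V)
    show "(F has_real_derivative f x) (at x)" if x: "x \<in> {0<..<1} - Z" for x
      unfolding F_def f_def using DERIV_V[OF x] by (auto intro!: derivative_eq_intros simp: algebra_simps)
  qed (use a in auto)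
  have r: "((\<lambda>x. f x + (2 * m * D - 2 * a\<^sup>2) * V x) has_integral
      F a - F 0 + (2 * m * D - 2 * a\<^sup>2) * integral {0..a} V) {0..a}"
    using integrable_V by (intro has_integral_add F has_integral_mult_right integrable_integral)
  have "2 * integral {0..a} (\<lambda>x. L x * (l x)\<^sup>2) = integral {0..a} (\<lambda>x. 2 * (L x * (l x)\<^sup>2))"
    by simp
  also have "\<dots> \<le> integral {0..a} (\<lambda>x. f x + (2 * m * D - 2 * a\<^sup>2) * V x)"
  proof (rule integral_le_off_finite[of "{a}"])
    show "(\<lambda>x. 2 * (L x * (l x)\<^sup>2)) integrable_on {0..a}"
      using a by (intro integrable_on_mult_right integrable_L_sq) auto
    show "(\<lambda>x. f x + (2 * m * D - 2 * a\<^sup>2) * V x) integrable_on {0..a}"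
      using r by (rule has_integral_integrable)
    fix x assume x: "x \<in> {0..a} - {a}"
    define v where "v = l x - a"
    have v: "0 \<le> v" "v \<le> D" "x * v \<le> V x" "0 \<le> V x"
      using x a ge[of x] l_le_1[of x] V_bounds(1,4)[of x] by (auto simp: v_def D_def)
    have mx: "m * x \<le> V x"
    proof -
      have "a * (m * x) \<le> a * V x" using V_bounds(2)[of x] x by (simp add: m(2) flip: w_def) (simp add: algebra_simps)
      then show ?thesis using a by simp
    qed
    \<comment> \<open>The resulting bound for \<open>V v\<close> combines the tangent, the chord and
      \<open>v <= D\<close>; it is exact when \<open>V\<close> is linear, with
      \<open>V = m x\<close> and \<open>v = m\<close>.\<close>
    have "m * (D * x - V x) \<le> m * (x * (D - v))"
      using m v by (intro mult_left_mono) (auto simp: algebra_simps)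
    also have "\<dots> = (m * x) * (D - v)" by simp
    also have "\<dots> \<le> V x * (D - v)" using mx v by (intro mult_right_mono) auto
    finally have "V x * v \<le> (D + m) * V x - m * D * x" by (simp add: algebra_simps)
    then have 1: "2 * v * (V x * v) \<le> 2 * v * ((D + m) * V x - m * D * x)"
      using v by (intro mult_left_mono) auto
    have 2: "(2 * a * v) * (x * v) \<le> (2 * a * v) * V x" using v a by (intro mult_left_mono) auto
    have "2 * (L x * (l x)\<^sup>2) = 2 * ((a * x + V x) * (a + v)\<^sup>2)" by (simp add: V_def v_def)
    also have "\<dots> = 2 * a\<^sup>2 * (a * x + V x) + 4 * a * (a * x + V x) * v + (2 * a * v) * (x * v) + 2 * v * (V x * v)"
      by (simp add: power2_eq_square algebra_simps)
    also have "\<dots> \<le> 2 * a\<^sup>2 * (a * x + V x) + 4 * a * (a * x + V x) * v + (2 * a * v) * V x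
        + 2 * v * ((D + m) * V x - m * D * x)"
      using 1 2 by linarith
    also have "\<dots> = f x + (2 * m * D - 2 * a\<^sup>2) * V x"
      unfolding f_def v_def[symmetric] by (simp add: power2_eq_square power3_eq_cube algebra_simps)
    finally show "2 * (L x * (l x)\<^sup>2) \<le> f x + (2 * m * D - 2 * a\<^sup>2) * V x" .
  qed simp
  also have "\<dots> = F a - F 0 + (2 * m * D - 2 * a\<^sup>2) * integral {0..a} V"
    using r by (rule integral_unique)
  also have "F a - F 0 = a ^ 5 + 4 * a ^ 3 * w + 3 * a * w\<^sup>2 - D * w\<^sup>2 + w ^ 3 / a"
  proof -
    have "F 0 = 0" by (simp add: F_def V_def)
    moreover have "m * w\<^sup>2 = w ^ 3 / a" using a by (simp add: m_def power2_eq_square power3_eq_cube)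
    moreover have "m * D * (a * w) = D * w\<^sup>2" by (simp add: m(2) power2_eq_square)
    moreover have "F a = a ^ 5 + 4 * a ^ 3 * w - 2 * (m * D * (a * w)) + 3 * a * w\<^sup>2 + D * w\<^sup>2 + m * w\<^sup>2"
      unfolding F_def w_def[symmetric] by (simp add: eval_nat_numeral algebra_simps)
    ultimately show ?thesis by linarith
  qed
  also have "2 * m * D = 2 * (1 - a) * w / a" by (simp add: m_def D_def)
  finally show ?thesis by (simp only: D_def)
qed

text \<open>A concave graph lies above its chord; here this comes from integrating
  \<open>(x V)' = V + x V' <= 2 V\<close>.\<close>

lemma integral_V_ge: "a * V a / 2 \<le> integral {0..a} V"
proof -
  have "((\<lambda>x. V x + x * (l x - a)) has_integral a * V a - 0 * V 0) {0..a}"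
  proof (rule ftc)
    show "continuous_on {0..a} (\<lambda>x. x * V x)" by (intro continuous_intros continuous_on_V)
    show "((\<lambda>x. x * V x) has_real_derivative V x + x * (l x - a)) (at x)" if x: "x \<in> {0<..<1} - Z" for x
      using DERIV_V[OF x] by (auto intro!: derivative_eq_intros)
  qed (use a in auto)
  then have i: "((\<lambda>x. V x + x * (l x - a)) has_integral a * V a) {0..a}" by simp
  have "integral {0..a} (\<lambda>x. V x + x * (l x - a)) \<le> integral {0..a} (\<lambda>x. 2 * V x)"
  proof (rule integral_le_off_finite[of "{a}"])
    show "V x + x * (l x - a) \<le> 2 * V x" if "x \<in> {0..a} - {a}" for x
      using V_bounds(1)[of x] that by auto
  qed (use has_integral_integrable[OF i] integrable_on_mult_right[OF integrable_V] in auto)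
  also have "\<dots> = 2 * integral {0..a} V" by simp
  finally show ?thesis using integral_unique[OF i] by simp
qed

text \<open>Since \<open>l <= 1\<close>, the slope of \<open>V\<close> is at most
  \<open>1 - a\<close>. Multiplied by \<open>V a - V\<close>, which is nonnegative, this integrates
  to the claim, the left side being an exact derivative.\<close>

lemma integral_V_le: "integral {0..a} V \<le> a * V a - (V a)\<^sup>2 / (2 * (1 - a))"
proof -
  have "((\<lambda>x. (V a - V x) * (l x - a)) has_integral
      (V a * V a - (V a)\<^sup>2 / 2) - (V a * V 0 - (V 0)\<^sup>2 / 2)) {0..a}"
  proof (rule ftc)
    show "continuous_on {0..a} (\<lambda>x. V a * V x - (V x)\<^sup>2 / 2)"
      by (intro continuous_intros continuous_on_V) auto
    show "((\<lambda>x. V a * V x - (V x)\<^sup>2 / 2) has_real_derivative (V a - V x) * (l x - a)) (at x)"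
      if x: "x \<in> {0<..<1} - Z" for x
      using DERIV_V[OF x] by (auto intro!: derivative_eq_intros simp: field_simps)
  qed (use a in auto)
  then have i: "((\<lambda>x. (V a - V x) * (l x - a)) has_integral (V a)\<^sup>2 / 2) {0..a}"
    by (simp add: V_def power2_eq_square)
  have j: "((\<lambda>x. (1 - a) * (V a - V x)) has_integral (1 - a) * (a * V a - integral {0..a} V)) {0..a}"
    using integrable_V has_integral_const_real[of "V a" 0 a] a
    by (intro has_integral_mult_right has_integral_diff integrable_integral) auto
  have "integral {0..a} (\<lambda>x. (V a - V x) * (l x - a)) \<le> integral {0..a} (\<lambda>x. (1 - a) * (V a - V x))"
  proof (rule integral_le_off_finite[of "{a}"])
    fix x assume x: "x \<in> {0..a} - {a}"
    have "(V a - V x) * (l x - a) \<le> (V a - V x) * (1 - a)"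
      using x a l_le_1[of x] V_bounds(3)[of x] by (intro mult_left_mono) auto
    then show "(V a - V x) * (l x - a) \<le> (1 - a) * (V a - V x)" by (simp add: mult.commute)
  qed (use has_integral_integrable[OF i] has_integral_integrable[OF j] in auto)
  then have "(V a)\<^sup>2 / 2 \<le> (1 - a) * (a * V a - integral {0..a} V)"
    unfolding integral_unique[OF i] integral_unique[OF j] .
  then show ?thesis using a by (simp add: field_simps)
qed

section \<open>The bound for sorted degree functions\<close>

lemma sorted_bound_interior:
  "2 * integral {0..1} (\<lambda>x. L x * (l x)\<^sup>2) \<le> max (star_value (L 1)) (sqrt (L 1 ^ 5))"
proof -
  define b where "b = L 1 - L a"
  define q where "q = integral {0..a} V"
  define G where "G = integral {a..1} (\<lambda>x. (l x)\<^sup>2)"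
  have b: "b = integral {a..1} l" using a by (simp add: b_def integral_l)
  have il: "l integrable_on {a..1}" and isq: "(\<lambda>x. (l x)\<^sup>2) integrable_on {a..1}"
    using a by (auto intro: integrable_l integrable_sq)
  have La: "L a = a\<^sup>2 + V a" by (simp add: V_def power2_eq_square)
  have "L a \<le> a * a + b"
    using degree_mass[of a] integral_min_crossing[of a "\<lambda>z. z"] a ge le il by (simp add: b L_def)
  then have Vb: "V a \<le> b" using La by (simp add: power2_eq_square)
  have "integral {a..1} l \<le> integral {a..1} (\<lambda>_. a)"
    using a le il by (intro integral_le_off_finite[of "{a}"]) auto
  then have ba: "b \<le> a * (1 - a)" using a by (simp add: b mult.commute)
  have "G \<le> integral {a..1} (\<lambda>x. a * l x)"
    unfolding G_def
  proof (rule integral_le_off_finite[of "{a}"])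
    fix x assume "x \<in> {a..1} - {a}"
    then show "(l x)\<^sup>2 \<le> a * l x"
      using a le[of x] l_nonneg[of x] by (auto simp: power2_eq_square intro: mult_right_mono)
  qed (use il isq in \<open>auto intro: integrable_on_mult_right\<close>)
  then have Ga: "G \<le> a * b" by (simp add: b)
  \<comment> \<open>This is \<open>degree_moment\<close> at the crossing point. Integration by parts
    turns its left side into the integral of \<open>L\<close> over \<open>[0,a]\<close>, the
    boundary terms being zero.\<close>
  have Gq: "G \<le> 2 * (a * b - q)"
  proof -
    have "((\<lambda>x. (a - x) * l x - L x) has_integral (a - a) * L a - (a - 0) * L 0) {0..a}"
    proof (rule ftc)
      show "continuous_on {0..a} (\<lambda>x. (a - x) * L x)"
        using a by (intro continuous_intros continuous_on_L) auto
      show "((\<lambda>x. (a - x) * L x) has_real_derivative (a - x) * l x - L x) (at x)"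
        if x: "x \<in> {0<..<1} - Z" for x
        using DERIV_L[OF x] by (auto intro!: derivative_eq_intros)
    qed (use a in auto)
    moreover have "(L has_integral a ^ 3 / 2 + q) {0..a}"
    proof -
      have "((\<lambda>x. a * x) has_integral a * (a\<^sup>2 / 2)) {0..a}"
        using ident_has_integral[of 0 a] a by (intro has_integral_mult_right) auto
      from has_integral_add[OF this integrable_integral[OF integrable_V]]
      show ?thesis by (simp add: V_def q_def power2_eq_square power3_eq_cube mult.assoc)
    qed
    ultimately have "((\<lambda>x. (a - x) * l x - L x + L x) has_integral 0 + (a ^ 3 / 2 + q)) {0..a}"
      by (intro has_integral_add) auto
    then have "integral {0..a} (\<lambda>x. (a - x) * l x) = a ^ 3 / 2 + q"
      by (intro integral_unique) simp
    moreover have "((\<lambda>y. a * l y - (l y)\<^sup>2 / 2) has_integral a * b - G / 2) {a..1}"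
      unfolding b G_def using il isq
      by (intro has_integral_diff has_integral_mult_right has_integral_divide integrable_integral)
    ultimately have "a ^ 3 / 2 + q \<le> a * (a * a - a\<^sup>2 / 2) + (a * b - G / 2)"
      using degree_moment[of a] integral_min_crossing[of a "\<lambda>z. a * z - z\<^sup>2 / 2"] a ge le
      by (auto simp: integral_unique has_integral_integrable)
    then show ?thesis by (simp add: power2_eq_square power3_eq_cube field_simps)
  qed
  have "integral {0..1} (\<lambda>x. L x * (l x)\<^sup>2)
      = integral {0..a} (\<lambda>x. L x * (l x)\<^sup>2) + integral {a..1} (\<lambda>x. L x * (l x)\<^sup>2)"
    using a by (intro Henstock_Kurzweil_Integration.integral_combine[symmetric] integrable_L_sq) auto
  then have "2 * integral {0..1} (\<lambda>x. L x * (l x)\<^sup>2)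
    \<le> a ^ 5 + 4 * a ^ 3 * V a + 3 * a * (V a)\<^sup>2 - (1 - a) * (V a)\<^sup>2 + (V a) ^ 3 / a
      + (2 * (1 - a) * V a / a - 2 * a\<^sup>2) * q + (2 * L 1 - b) * G"
    using head_bound tail_bound[of a] a by (simp add: q_def b_def G_def)
  also have "\<dots> \<le> max (star_value (L 1)) (sqrt (L 1 ^ 5))"
    using a V_a_nonneg Vb ba integral_V_ge integral_V_le Ga Gq
    by (intro degree_polynomial_bound) (auto simp: q_def b_def La)
  finally show ?thesis .
qed

end

theorem sorted_bound:
  "2 * integral {0..1} (\<lambda>x. L x * (l x)\<^sup>2) \<le> max (star_value (L 1)) (sqrt (L 1 ^ 5))"
proof -
  obtain a where a: "0 \<le> a" "a \<le> 1" and ge: "\<And>x. 0 \<le> x \<Longrightarrow> x < a \<Longrightarrow> a \<le> l x"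
    and le: "\<And>x. a < x \<Longrightarrow> x \<le> 1 \<Longrightarrow> l x \<le> a"
    using crossing by blast
  \<comment> \<open>The interior estimates divide by \<open>a\<close> and \<open>1 - a\<close>. At
    \<open>a = 0\<close> the energy vanishes; \<open>a = 1\<close> forces the full mass
    \<open>L 1 = 1\<close>, where the clique value is \<open>1\<close>.\<close>
  consider "a = 0" | "a = 1" | "0 < a" "a < 1" using a by linarith
  then show ?thesis
  proof cases
    case 1
    have "integral {0..1} (\<lambda>x. L x * (l x)\<^sup>2) \<le> integral {0..1} (\<lambda>x::real. 0)"
    proof (rule integral_le_off_finite[of "{0}"])
      fix x :: real assume "x \<in> {0..1} - {0}"
      then have "l x = 0" using le[of x] l_nonneg[of x] 1 by auto
      then show "L x * (l x)\<^sup>2 \<le> 0" by simp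
    qed (auto intro: integrable_L_sq)
    moreover have "0 \<le> sqrt (L 1 ^ 5)" using L_nonneg[of 1] by simp
    ultimately show ?thesis by (simp only: integral_0 le_max_iff_disj) linarith
  next
    case 2
    have "y \<le> L 1" if "0 < y" "y < 1" for y
    proof -
      have "y * 1 \<le> y * l y" using ge[of y] that 2 by (intro mult_left_mono) auto
      also have "\<dots> \<le> L y" using L_diff_bounds(1)[of 0 y] that by simp
      also have "\<dots> \<le> L 1" using L_mono[of y 1] that by simp
      finally show ?thesis by simp
    qed
    then have "1 \<le> L 1" using dense_le_bounded[of 0 1 "L 1"] by auto
    then have "L 1 = 1" using L_le[of 1] by simp
    have "integral {0..1} (\<lambda>x. L x * (l x)\<^sup>2) \<le> integral {0..1} (\<lambda>x. x)"
    proof (rule integral_le)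
      fix x :: real assume x: "x \<in> {0..1}"
      have "L x * (l x)\<^sup>2 \<le> x * 1"
        using x L_le[of x] L_nonneg[of x] l_nonneg[of x] l_le_1[of x]
        by (intro mult_mono) (auto simp: power_le_one)
      then show "L x * (l x)\<^sup>2 \<le> x" by simp
    qed (auto intro: integrable_L_sq integrable_continuous_real)
    also have "\<dots> = 1/2" by simp
    finally show ?thesis using \<open>L 1 = 1\<close> by simp
  next
    case 3
    then show ?thesis using ge le by (rule sorted_bound_interior)
  qed
qed

end

subsection \<open>Step kernels\<close>

lemma step_LBINT:
  fixes t :: "nat \<Rightarrow> real" and f :: "real \<Rightarrow> real"
  assumes t: "t 0 = 0" "t K = 1" "\<And>i. i < K \<Longrightarrow> t i \<le> t (Suc i)"
    and f: "\<And>i x. i < K \<Longrightarrow> t i \<le> x \<Longrightarrow> x < t (Suc i) \<Longrightarrow> f x = g i"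
  shows "set_integrable lborel {0..<1} f"
    and "(LBINT x:{0..<1}. f x) = (\<Sum>i<K. (t (Suc i) - t i) * g i)"
proof -
  \<comment> \<open>The inequality \<open>t 0 <= t k\<close> is carried through the induction so
    that \<open>[t 0, t (Suc k))\<close> splits at \<open>t k\<close>.\<close>
  have "indicator {t 0..<t k} x *\<^sub>R f x = (\<Sum>i<k. g i * indicator {t i..<t (Suc i)} x)
      \<and> t 0 \<le> t k" if "k \<le> K" for k x
    using that
  proof (induction k)
    case (Suc k)
    then have IH: "indicator {t 0..<t k} x *\<^sub>R f x = (\<Sum>i<k. g i * indicator {t i..<t (Suc i)} x)"
      "t 0 \<le> t k" and k: "t k \<le> t (Suc k)" using t by auto
    have "indicator {t 0..<t (Suc k)} x *\<^sub>R f x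
      = indicator {t 0..<t k} x *\<^sub>R f x + indicator {t k..<t (Suc k)} x * f x"
      using IH(2) k by (auto simp: indicator_def)
    also have "indicator {t k..<t (Suc k)} x * f x = g k * indicator {t k..<t (Suc k)} x"
      using f[of k x] Suc.prems by (auto simp: indicator_def)
    finally show ?case using IH k by simp
  qed auto
  from this[of K] t have eq: "(\<lambda>x. indicator {0..<1} x *\<^sub>R f x)
      = (\<lambda>x. \<Sum>i<K. g i * indicator {t i..<t (Suc i)} x)" by auto
  show "set_integrable lborel {0..<1} f"
    unfolding set_integrable_def eq
    by (intro Bochner_Integration.integrable_sum integrable_mult_right integrable_real_indicator)
      (use t in auto)
  have "(LBINT x:{0..<1}. f x) = (\<Sum>i<K. LBINT x. g i * indicator {t i..<t (Suc i)} x)"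
    unfolding set_lebesgue_integral_def eq
    by (intro Bochner_Integration.integral_sum integrable_mult_right integrable_real_indicator)
      (use t in auto)
  also have "\<dots> = (\<Sum>i<K. (t (Suc i) - t i) * g i)"
    using t by (intro sum.cong) (auto simp: mult.commute)
  finally show "(LBINT x:{0..<1}. f x) = (\<Sum>i<K. (t (Suc i) - t i) * g i)" .
qed

lemma step_has_integral:
  fixes t :: "nat \<Rightarrow> real" and f :: "real \<Rightarrow> real"
  assumes t: "t 0 = 0" "t K = 1" "\<And>i. i < K \<Longrightarrow> t i \<le> t (Suc i)"
    and f: "\<And>i x. i < K \<Longrightarrow> t i \<le> x \<Longrightarrow> x < t (Suc i) \<Longrightarrow> f x = g i"
  shows "(f has_integral (\<Sum>i<K. (t (Suc i) - t i) * g i)) {0..1}"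
proof -
  have "(f has_integral (\<Sum>i<K. (t (Suc i) - t i) * g i)) {0..<1}"
    using step_LBINT[where g = g and f = f, OF t f]
    by (metis has_integral_integrable_integral set_borel_integral_eq_integral)
  then show ?thesis
    by (subst has_integral_spike_set_eq[of _ "{0..<1}"]) (auto intro: negligible_subset[of "{1}"])
qed

lemma deg_step:
  fixes t :: "nat \<Rightarrow> real"
  assumes t: "t 0 = 0" "t K = 1" "\<And>i. i < K \<Longrightarrow> t i \<le> t (Suc i)"
    and A: "\<And>i j x y. i < K \<Longrightarrow> j < K \<Longrightarrow> t i \<le> x \<Longrightarrow> x < t (Suc i) \<Longrightarrow>
      t j \<le> y \<Longrightarrow> y < t (Suc j) \<Longrightarrow> A x y = M i j"
    and i: "i < K" "t i \<le> x" "x < t (Suc i)"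
  shows "deg A x = (\<Sum>j<K. (t (Suc j) - t j) * M i j)"
  unfolding deg_def by (rule step_LBINT(2)[OF t]) (use A i in auto)

lemma S_step:
  fixes t :: "nat \<Rightarrow> real"
  assumes t: "t 0 = 0" "t K = 1" "\<And>i. i < K \<Longrightarrow> t i \<le> t (Suc i)"
    and A: "\<And>i j x y. i < K \<Longrightarrow> j < K \<Longrightarrow> t i \<le> x \<Longrightarrow> x < t (Suc i) \<Longrightarrow>
      t j \<le> y \<Longrightarrow> y < t (Suc j) \<Longrightarrow> A x y = M i j"
  defines "p \<equiv> \<lambda>i. t (Suc i) - t i"
  defines "d \<equiv> \<lambda>i. \<Sum>j<K. p j * M i j"
  shows "S A = (\<Sum>j<K. p j * (\<Sum>i<K. p i * (d i * d j * min (d i) (d j))))"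
proof -
  have d: "deg A x = d i" if "i < K" "t i \<le> x" "x < t (Suc i)" for i x
    unfolding d_def p_def using deg_step[OF t A that] by auto
  have inner: "(LBINT x:{0..<1}. deg A x * deg A y * min (deg A x) (deg A y))
    = (\<Sum>i<K. p i * (d i * d j * min (d i) (d j)))" if "j < K" "t j \<le> y" "y < t (Suc j)" for j y
    unfolding p_def by (rule step_LBINT(2)[OF t]) (use d that in auto)
  show ?thesis
    unfolding S_def p_def by (rule step_LBINT(2)[OF t]) (use inner in \<open>auto simp: p_def\<close>)
qed

text \<open>\<open>A1 c\<close> is a kernel with two steps meeting at \<open>s\<close>, where
  \<open>c = 2 s - s^2\<close>; in terms of \<open>s\<close> both sides are polynomials.\<close>

lemma S_A1:
  assumes "0 \<le> c" "c \<le> 1"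
  shows "S (A1 c) = star_value c"
proof -
  define s where "s = 1 - sqrt (1 - c)"
  have s: "0 \<le> s" "s \<le> 1" and r: "sqrt (1 - c) = 1 - s"
    using assms by (auto simp: s_def)
  have "(1 - s)\<^sup>2 = 1 - c" using assms by (simp flip: r)
  then have c: "c = 2 * s - s\<^sup>2" by (simp add: power2_eq_square algebra_simps)
  define t :: "nat \<Rightarrow> real" where "t = (\<lambda>i. if i = 0 then 0 else if i = 1 then s else 1)"
  define M :: "nat \<Rightarrow> nat \<Rightarrow> real" where "M = (\<lambda>i j. if i = 0 \<or> j = 0 then 1 else 0)"
  have "S (A1 c) = (\<Sum>j<2. (t (Suc j) - t j) * (\<Sum>i<2. (t (Suc i) - t i) *
      ((\<Sum>k<2. (t (Suc k) - t k) * M i k) * (\<Sum>k<2. (t (Suc k) - t k) * M j k) *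
       min (\<Sum>k<2. (t (Suc k) - t k) * M i k) (\<Sum>k<2. (t (Suc k) - t k) * M j k))))"
    by (rule S_step) (use s in \<open>auto simp: t_def M_def A1_def less_2_cases_iff simp flip: s_def split: if_splits\<close>)
  also have "\<dots> = star_value c"
    unfolding star_value_def r unfolding c using s
    by (simp add: t_def M_def eval_nat_numeral min_def algebra_simps)
  finally show ?thesis .
qed

lemma S_A2:
  assumes "0 \<le> c" "c \<le> 1"
  shows "S (A2 c) = sqrt (c ^ 5)"
proof -
  define s where "s = sqrt c"
  have s: "0 \<le> s" "s \<le> 1" using assms by (auto simp: s_def)
  define t :: "nat \<Rightarrow> real" where "t = (\<lambda>i. if i = 0 then 0 else if i = 1 then s else 1)"
  define M :: "nat \<Rightarrow> nat \<Rightarrow> real" where "M = (\<lambda>i j. if i = 0 \<and> j = 0 then 1 else 0)"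
  have "S (A2 c) = (\<Sum>j<2. (t (Suc j) - t j) * (\<Sum>i<2. (t (Suc i) - t i) *
      ((\<Sum>k<2. (t (Suc k) - t k) * M i k) * (\<Sum>k<2. (t (Suc k) - t k) * M j k) *
       min (\<Sum>k<2. (t (Suc k) - t k) * M i k) (\<Sum>k<2. (t (Suc k) - t k) * M j k))))"
    by (rule S_step) (use s in \<open>auto simp: t_def M_def A2_def less_2_cases_iff simp flip: s_def split: if_splits\<close>)
  also have "\<dots> = s ^ 5"
    using s by (simp add: t_def M_def eval_nat_numeral)
  finally show ?thesis by (simp add: s_def real_sqrt_power)
qed

section \<open>Sorting the steps, and the bathtub principle\<close>

text \<open>\<open>\<sigma> x\<close> is the index of the original step found at \<open>x\<close>
  once the steps, with their widths kept, are lined up in nonincreasing order of \<open>d\<close>.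
  Every function of the index keeps its integral.\<close>

lemma sorted_rearrangement:
  fixes p d :: "nat \<Rightarrow> real"
  assumes K: "0 < K" and p: "\<And>i. i < K \<Longrightarrow> 0 < p i" "(\<Sum>i<K. p i) = 1"
  obtains \<sigma> :: "real \<Rightarrow> nat" and Z where "finite Z" "\<And>x. \<sigma> x < K"
    "\<And>x y. x \<le> y \<Longrightarrow> d (\<sigma> y) \<le> d (\<sigma> x)"
    "\<And>h x. x \<notin> Z \<Longrightarrow> isCont (\<lambda>x. h (\<sigma> x) :: real) x"
    "\<And>h. ((\<lambda>x. h (\<sigma> x)) has_integral (\<Sum>i<K. p i * h i)) {0..1}"
proof -
  define xs where "xs = sort_key (\<lambda>i. - d i) [0..<K]"
  define \<pi> where "\<pi> i = xs ! i" for i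
  have xs: "length xs = K" "distinct xs" "set xs = {..<K}" "sorted (map (\<lambda>i. - d i) xs)"
    by (auto simp: xs_def)
  have bij: "bij_betw \<pi> {..<K} {..<K}"
  proof -
    have "\<pi> = (!) xs" by (auto simp: \<pi>_def)
    then show ?thesis using bij_betw_nth[OF xs(2) refl refl] xs(1,3) by simp
  qed
  have \<pi>K: "\<pi> i < K" if "i < K" for i using bij that by (auto simp: bij_betw_def)
  have anti: "d (\<pi> j) \<le> d (\<pi> i)" if "i \<le> j" "j < K" for i j
    using sorted_nth_mono[OF xs(4), of i j] that xs(1) by (simp add: \<pi>_def)
  define t where "t k = (\<Sum>i<k. p (\<pi> i))" for k
  have tSuc: "t (Suc i) - t i = p (\<pi> i)" for i by (simp add: t_def)
  have t: "t 0 = 0" "t K = 1"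
    using p(2) sum.reindex_bij_betw[OF bij, of p] by (auto simp: t_def)
  have tlt: "t i < t (Suc i)" if "i < K" for i using tSuc[of i] p(1)[OF \<pi>K[OF that]] by linarith
  have tmono: "t i \<le> t j" if "i \<le> j" "j \<le> K" for i j
    using that
  proof (induction j)
    case (Suc j)
    then show ?case using tlt[of j] by (cases "i = Suc j") auto
  qed simp
  \<comment> \<open>Counting only the inner breakpoints keeps the index below \<open>K\<close> at
    \<open>x = 1\<close> and beyond, and makes it monotone on the whole line.\<close>
  define idx where "idx x = card {i \<in> {1..<K}. t i \<le> x}" for x
  have idxK: "idx x < K" for x
  proof -
    have "idx x \<le> card {1..<K}" unfolding idx_def by (intro card_mono) auto
    then show ?thesis using K by simp
  qed
  have idx_eq: "idx x = i" if "i < K" "t i \<le> x" "x < t (Suc i)" for i x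
  proof -
    have "{j \<in> {1..<K}. t j \<le> x} = {1..i}"
    proof (intro set_eqI iffI)
      fix j assume "j \<in> {j \<in> {1..<K}. t j \<le> x}"
      then show "j \<in> {1..i}" using tmono[of "Suc i" j] that by (cases "j \<le> i") auto
    next
      fix j assume "j \<in> {1..i}"
      then show "j \<in> {j \<in> {1..<K}. t j \<le> x}" using tmono[of j i] that by auto
    qed
    then show ?thesis by (simp add: idx_def)
  qed
  have idx_mono: "idx x \<le> idx y" if "x \<le> y" for x y
    unfolding idx_def using that by (intro card_mono) auto
  show ?thesis
  proof (rule that[of "t ` {1..<K}" "\<lambda>x. \<pi> (idx x)"])
    show "\<pi> (idx x) < K" for x using \<pi>K idxK by blast
    show "d (\<pi> (idx y)) \<le> d (\<pi> (idx x))" if "x \<le> y" for x y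
      using anti[OF idx_mono[OF that] idxK] .
    show "isCont (\<lambda>x. h (\<pi> (idx x)) :: real) x" if x: "x \<notin> t ` {1..<K}" for h x
    proof -
      \<comment> \<open>Off the breakpoints the index is locally constant, hence so is every
        function of it.\<close>
      have "\<forall>\<^sub>F y in nhds x. \<forall>i\<in>{1..<K}. t i \<le> y \<longleftrightarrow> t i \<le> x"
      proof (intro eventually_ball_finite ballI)
        fix i assume "i \<in> {1..<K}"
        then have "t i \<noteq> x" using x by auto
        then consider "t i < x" | "x < t i" by linarith
        then show "\<forall>\<^sub>F y in nhds x. t i \<le> y \<longleftrightarrow> t i \<le> x"
        proof cases
          case 1
          then have "\<forall>\<^sub>F y in nhds x. y \<in> {t i<..}" by (intro eventually_nhds_in_open) auto
          then show ?thesis by eventually_elim (use 1 in auto)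
        next
          case 2
          then have "\<forall>\<^sub>F y in nhds x. y \<in> {..<t i}" by (intro eventually_nhds_in_open) auto
          then show ?thesis by eventually_elim (use 2 in auto)
        qed
      qed auto
      then have "\<forall>\<^sub>F y in nhds x. h (\<pi> (idx y)) = h (\<pi> (idx x))"
      proof eventually_elim
        case (elim y)
        then have "{i \<in> {1..<K}. t i \<le> y} = {i \<in> {1..<K}. t i \<le> x}" by auto
        then show ?case by (simp add: idx_def)
      qed
      then have "isCont (\<lambda>y. h (\<pi> (idx y))) x \<longleftrightarrow> isCont (\<lambda>_. h (\<pi> (idx x))) x"
        by (rule isCont_cong)
      then show ?thesis by simp
    qed
    show "((\<lambda>x. h (\<pi> (idx x))) has_integral (\<Sum>i<K. p i * h i)) {0..1}" for h :: "nat \<Rightarrow> real"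
    proof -
      have "((\<lambda>x. h (\<pi> (idx x))) has_integral (\<Sum>i<K. (t (Suc i) - t i) * h (\<pi> i))) {0..1}"
        by (rule step_has_integral[OF t]) (use tlt idx_eq in \<open>auto intro: less_imp_le\<close>)
      also have "(\<Sum>i<K. (t (Suc i) - t i) * h (\<pi> i)) = (\<Sum>i<K. p i * h i)"
        using sum.reindex_bij_betw[OF bij, of "\<lambda>i. p i * h i"] by (simp add: tSuc)
      finally show ?thesis .
    qed
  qed auto
qed

text \<open>The moment is largest when the mass is packed to the left at full height, that is for
  the indicator of \<open>[0, min a m]\<close>, whose moment is the stated bound.\<close>

lemma bathtub:
  fixes \<phi> :: "real \<Rightarrow> real"
  assumes \<phi>: "\<And>x. x \<in> {0..1} \<Longrightarrow> 0 \<le> \<phi> x \<and> \<phi> x \<le> 1" "(\<phi> has_integral m) {0..1}"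
    and a: "0 \<le> a" "a \<le> 1"
  shows "integral {0..a} \<phi> \<le> min a m"
    and "integral {0..a} (\<lambda>x. (a - x) * \<phi> x) \<le> a * min a m - (min a m)\<^sup>2 / 2"
    and "(\<lambda>x. (a - x) * \<phi> x) integrable_on {0..a}"
proof -
  define z where "z = min a m"
  have "0 \<le> m" using \<phi> by (intro has_integral_nonneg[OF \<phi>(2)]) auto
  then have z: "0 \<le> z" "z \<le> a" using a by (auto simp: z_def)
  have i01: "\<phi> integrable_on {0..1}" using \<phi>(2) by (rule has_integral_integrable)
  have i: "\<phi> integrable_on {0..a}"
    by (rule integrable_subinterval_real[OF i01]) (use a in auto)
  have meas: "\<phi> \<in> borel_measurable (lebesgue_on {0..1})"
    using i01 by (rule integrable_imp_measurable)
  have int: "(\<lambda>x. (k - x) * \<phi> x) integrable_on {s..t}" if "0 \<le> s" "t \<le> 1" for k s t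
  proof (rule integrable_subinterval_real)
    show "(\<lambda>x. (k - x) * \<phi> x) integrable_on {0..1}"
    proof (rule integrable_on_bounded_measurable)
      have "(\<lambda>x. k - x) \<in> borel_measurable (lebesgue_on {0..1})"
        by (intro continuous_imp_measurable_on_sets_lebesgue continuous_intros) auto
      then show "(\<lambda>x. (k - x) * \<phi> x) \<in> borel_measurable (lebesgue_on {0..1})"
        using meas by (intro borel_measurable_times)
      show "\<bar>(k - x) * \<phi> x\<bar> \<le> (\<bar>k\<bar> + 1) * 1" if "x \<in> {0..1}" for x
        using \<phi>(1)[OF that] that unfolding abs_mult by (intro mult_mono) auto
    qed
  qed (use that in auto)
  show "(\<lambda>x. (a - x) * \<phi> x) integrable_on {0..a}" using a by (intro int) auto
  have "integral {0..a} \<phi> \<le> integral {0..1} \<phi>"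
    using a i i01 \<phi>(1) by (intro integral_subset_le) auto
  moreover have "integral {0..a} \<phi> \<le> integral {0..a} (\<lambda>_. 1)"
    using a i \<phi>(1) by (intro integral_le) auto
  ultimately show 1: "integral {0..a} \<phi> \<le> min a m"
    using \<phi>(2) a by (simp add: integral_unique)
  \<comment> \<open>The weight is split as \<open>a - x = (z - x) + (a - z)\<close>. The first part
    changes sign at \<open>z\<close>, so \<open>\<phi>\<close> is bounded by \<open>1\<close> before
    \<open>z\<close> and by \<open>0\<close> after it; the second part is left to the mass
    bound.\<close>
  have "integral {0..a} (\<lambda>x. (z - x) * \<phi> x)
      = integral {0..z} (\<lambda>x. (z - x) * \<phi> x) + integral {z..a} (\<lambda>x. (z - x) * \<phi> x)"
    using z a by (intro Henstock_Kurzweil_Integration.integral_combine[symmetric] int) auto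
  also have "\<dots> \<le> integral {0..z} (\<lambda>x. z - x) + integral {z..a} (\<lambda>_. 0)"
  proof (intro add_mono integral_le int)
    show "(z - x) * \<phi> x \<le> z - x" if "x \<in> {0..z}" for x
      using \<phi>(1)[of x] that z a mult_left_mono[of "\<phi> x" 1 "z - x"] by auto
    show "(z - x) * \<phi> x \<le> 0" if "x \<in> {z..a}" for x
      using \<phi>(1)[of x] that z a by (auto simp: mult_nonpos_nonneg)
  qed (use z a in \<open>auto intro!: integrable_continuous_real continuous_intros\<close>)
  also have "\<dots> = z\<^sup>2 / 2"
    using z by (simp add: integral_diff integrable_continuous_real power2_eq_square)
  finally have 2: "integral {0..a} (\<lambda>x. (z - x) * \<phi> x) \<le> z\<^sup>2 / 2" .
  have "integral {0..a} (\<lambda>x. (a - x) * \<phi> x) = integral {0..a} (\<lambda>x. (z - x) * \<phi> x + (a - z) * \<phi> x)"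
    by (simp add: algebra_simps)
  also have "\<dots> = integral {0..a} (\<lambda>x. (z - x) * \<phi> x) + (a - z) * integral {0..a} \<phi>"
    using i a by (subst integral_add) (auto intro: int integrable_on_mult_right)
  also have "\<dots> \<le> z\<^sup>2 / 2 + (a - z) * z"
    using 1 2 z by (intro add_mono mult_left_mono) (auto simp: z_def)
  finally show "integral {0..a} (\<lambda>x. (a - x) * \<phi> x) \<le> a * min a m - (min a m)\<^sup>2 / 2"
    unfolding z_def[symmetric] by (simp add: power2_eq_square field_simps)
qed

text \<open>Only the rows of \<open>M\<close> are rearranged. Each column becomes a function with
  values in \<open>[0,1]\<close> and, by symmetry, mass \<open>d j\<close>. Summing
  \<open>bathtub\<close> over the columns with weights \<open>p j\<close> yields
  \<open>degree_mass\<close> and \<open>degree_moment\<close>.\<close>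

lemma discrete_bound:
  fixes p :: "nat \<Rightarrow> real" and M :: "nat \<Rightarrow> nat \<Rightarrow> real"
  assumes K: "0 < K" and p: "\<And>i. i < K \<Longrightarrow> 0 < p i" "(\<Sum>i<K. p i) = 1"
    and M: "\<And>i j. i < K \<Longrightarrow> j < K \<Longrightarrow> 0 \<le> M i j \<and> M i j \<le> 1"
      "\<And>i j. i < K \<Longrightarrow> j < K \<Longrightarrow> M i j = M j i"
  defines "d \<equiv> \<lambda>i. \<Sum>j<K. p j * M i j"
  defines "c \<equiv> \<Sum>i<K. p i * d i"
  shows "(\<Sum>j<K. p j * (\<Sum>i<K. p i * (d i * d j * min (d i) (d j))))
    \<le> max (star_value c) (sqrt (c ^ 5))"
proof -
  obtain \<sigma> :: "real \<Rightarrow> nat" and Z where Z: "finite Z" and \<sigma>K: "\<And>x. \<sigma> x < K"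
    and anti: "\<And>x y. x \<le> y \<Longrightarrow> d (\<sigma> y) \<le> d (\<sigma> x)"
    and cont: "\<And>h x. x \<notin> Z \<Longrightarrow> isCont (\<lambda>x. h (\<sigma> x) :: real) x"
    and int: "\<And>h. ((\<lambda>x. h (\<sigma> x)) has_integral (\<Sum>i<K. p i * h i)) {0..1}"
    using sorted_rearrangement[OF K p, of d] by metis
  have d0: "0 \<le> d i" "d i \<le> 1" if "i < K" for i
  proof -
    show "0 \<le> d i" unfolding d_def using M p that by (intro sum_nonneg mult_nonneg_nonneg) (auto intro: less_imp_le)
    have "d i \<le> (\<Sum>j<K. p j * 1)"
      unfolding d_def using M p that by (intro sum_mono mult_left_mono) (auto intro: less_imp_le)
    then show "d i \<le> 1" using p by simp
  qed
  define \<phi> where "\<phi> j x = M (\<sigma> x) j" for j x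
  have \<phi>01: "0 \<le> \<phi> j x \<and> \<phi> j x \<le> 1" if "j < K" for j x
    using M(1)[OF \<sigma>K that] by (simp add: \<phi>_def)
  have \<phi>int: "(\<phi> j has_integral d j) {0..1}" if "j < K" for j
  proof -
    have "(\<Sum>i<K. p i * M i j) = d j"
      unfolding d_def using M(2) that by (intro sum.cong) auto
    then show ?thesis using int[of "\<lambda>i. M i j"] by (simp add: \<phi>_def[abs_def])
  qed
  have dsum: "d (\<sigma> x) = (\<Sum>j<K. p j * \<phi> j x)" for x by (simp add: d_def \<phi>_def)
  interpret sorted_degree "\<lambda>x. d (\<sigma> x)" Z
  proof
    fix a :: real assume a: "0 \<le> a" "a \<le> 1"
    have ii: "\<phi> j integrable_on {0..a}" if "j < K" for j
      by (rule integrable_subinterval_real[OF has_integral_integrable[OF \<phi>int[OF that]]]) (use a in auto)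
    have "integral {0..a} (\<lambda>x. d (\<sigma> x)) = (\<Sum>j<K. p j * integral {0..a} (\<phi> j))"
      unfolding dsum using ii by (subst integral_sum) (auto intro: integrable_on_mult_right)
    also have "\<dots> \<le> (\<Sum>j<K. p j * min a (d j))"
      using p \<phi>01 \<phi>int a by (intro sum_mono mult_left_mono bathtub) (auto intro: less_imp_le)
    also have "\<dots> = integral {0..1} (\<lambda>y. min a (d (\<sigma> y)))"
      using integral_unique[OF int[of "\<lambda>j. min a (d j)"]] by simp
    finally show "integral {0..a} (\<lambda>x. d (\<sigma> x)) \<le> integral {0..1} (\<lambda>y. min a (d (\<sigma> y)))" .
    have "integral {0..a} (\<lambda>x. (a - x) * d (\<sigma> x))
        = integral {0..a} (\<lambda>x. \<Sum>j<K. p j * ((a - x) * \<phi> j x))"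
      unfolding dsum by (simp add: sum_distrib_left mult.left_commute)
    also have "\<dots> = (\<Sum>j<K. p j * integral {0..a} (\<lambda>x. (a - x) * \<phi> j x))"
      using \<phi>01 \<phi>int a by (subst integral_sum) (auto intro!: integrable_on_mult_right bathtub)
    also have "\<dots> \<le> (\<Sum>j<K. p j * (a * min a (d j) - (min a (d j))\<^sup>2 / 2))"
      using p \<phi>01 \<phi>int a by (intro sum_mono mult_left_mono bathtub) (auto intro: less_imp_le)
    also have "\<dots> = integral {0..1} (\<lambda>y. a * min a (d (\<sigma> y)) - (min a (d (\<sigma> y)))\<^sup>2 / 2)"
      using integral_unique[OF int[of "\<lambda>j. a * min a (d j) - (min a (d j))\<^sup>2 / 2"]] by simp
    finally show "integral {0..a} (\<lambda>x. (a - x) * d (\<sigma> x))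
      \<le> integral {0..1} (\<lambda>y. a * min a (d (\<sigma> y)) - (min a (d (\<sigma> y)))\<^sup>2 / 2)" .
  qed (use Z cont anti d0 \<sigma>K in auto)
  have "L 1 = c" using integral_unique[OF int[of d]] by (simp add: L_def c_def)
  moreover have "integral {0..1} (\<lambda>y. integral {0..1} (\<lambda>x. d (\<sigma> x) * d (\<sigma> y) * min (d (\<sigma> x)) (d (\<sigma> y))))
    = (\<Sum>j<K. p j * (\<Sum>i<K. p i * (d i * d j * min (d i) (d j))))"
  proof -
    have "integral {0..1} (\<lambda>x. d (\<sigma> x) * d (\<sigma> y) * min (d (\<sigma> x)) (d (\<sigma> y)))
      = (\<Sum>i<K. p i * (d i * d (\<sigma> y) * min (d i) (d (\<sigma> y))))" for y
      using integral_unique[OF int[of "\<lambda>i. d i * d (\<sigma> y) * min (d i) (d (\<sigma> y))"]] .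
    then show ?thesis
      using integral_unique[OF int[of "\<lambda>j. \<Sum>i<K. p i * (d i * d j * min (d i) (d j))"]] by simp
  qed
  ultimately show ?thesis using energy_eq sorted_bound by simp
qed

section \<open>Passage from the step kernel to finite sums\<close>

theorem theorem7:
  fixes c :: real and K :: nat and A :: "real \<Rightarrow> real \<Rightarrow> real" and q :: "nat \<Rightarrow> real"
  assumes "0 \<le> c" and "c \<le> 1" and "K > 0"
    and "\<forall>x\<in>{0..<1}. \<forall>y\<in>{0..<1}. A x y \<in> {0..1}"
    and "(LBINT y:{0..<1}. LBINT x:{0..<1}. A x y) = c"
    and "\<forall>x\<in>{0..<1}. \<forall>y\<in>{0..<1}. A x y = A y x"
    and "q 0 = 0" and "q K = 1" and "\<forall>i\<in>{1..K}. q (i - 1) < q i"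
    and "\<forall>i\<in>{1..K}. \<forall>j\<in>{1..K}.
           (\<lambda>(x, y). A x y) constant_on ({q (i - 1)..<q i} \<times> {q (j - 1)..<q j})"
  shows "S A \<le> max (S (A1 c)) (S (A2 c)) \<and>
         max (S (A1 c)) (S (A2 c)) =
           max ((1 - sqrt (1 - c))\<^sup>2 * ((c + 1) * sqrt (1 - c) + c)) (c powr (5 / 2))"
proof -
  define p where "p i = q (Suc i) - q i" for i
  \<comment> \<open>The value of a block is read at its lower left corner, which belongs to the
    half-open rectangle.\<close>
  define M where "M i j = A (q i) (q j)" for i j
  define d where "d i = (\<Sum>j<K. p j * M i j)" for i
  have qlt: "q i < q (Suc i)" if "i < K" for i using assms(9)[rule_format, of "Suc i"] that by simp
  have qle: "q i \<le> q (Suc i)" if "i < K" for i using qlt[OF that] by simp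
  have qmono: "q i \<le> q j" if "i \<le> j" "j \<le> K" for i j
    using that
  proof (induction j)
    case (Suc j)
    then show ?case using qlt[of j] by (cases "i = Suc j") auto
  qed simp
  have q01: "q i \<in> {0..<1}" if "i < K" for i
    using qmono[of 0 i] qlt[OF that] qmono[of "Suc i" K] that assms(7,8) by auto
  have A: "A x y = M i j" if "i < K" "j < K" "q i \<le> x" "x < q (Suc i)" "q j \<le> y" "y < q (Suc j)"
    for i j x y
  proof -
    have "(\<lambda>(x, y). A x y) constant_on ({q i..<q (Suc i)} \<times> {q j..<q (Suc j)})"
      using assms(10)[rule_format, of "Suc i" "Suc j"] that by simp
    then obtain k where k: "\<And>z. z \<in> {q i..<q (Suc i)} \<times> {q j..<q (Suc j)} \<Longrightarrow> (\<lambda>(x, y). A x y) z = k"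
      unfolding constant_on_def by blast
    show ?thesis using k[of "(x, y)"] k[of "(q i, q j)"] that qlt[of i] qlt[of j] by (simp add: M_def)
  qed
  have Msym: "M i j = M j i" if "i < K" "j < K" for i j
    using assms(6) q01 that by (auto simp: M_def)
  have "S A = (\<Sum>j<K. p j * (\<Sum>i<K. p i * (d i * d j * min (d i) (d j))))"
    unfolding p_def d_def by (rule S_step[OF assms(7,8) qle A])
  also have "\<dots> \<le> max (star_value (\<Sum>i<K. p i * d i)) (sqrt ((\<Sum>i<K. p i * d i) ^ 5))"
    unfolding d_def
  proof (rule discrete_bound)
    show "(\<Sum>i<K. p i) = 1" using assms(7,8) sum_lessThan_telescope[of q K] by (simp add: p_def)
    show "0 \<le> M i j \<and> M i j \<le> 1" if "i < K" "j < K" for i j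
      using assms(4) q01 that by (auto simp: M_def)
  qed (use assms(3) qlt Msym in \<open>auto simp: p_def\<close>)
  also have "(\<Sum>i<K. p i * d i) = c"
  proof -
    \<comment> \<open>The prescribed mass integrates over \<open>x\<close> first and so produces
      column sums; symmetry turns them into the row sums \<open>d j\<close>.\<close>
    have "(LBINT x:{0..<1}. A x y) = d j" if "j < K" "q j \<le> y" "y < q (Suc j)" for j y
    proof -
      have "(LBINT x:{0..<1}. A x y) = (\<Sum>i<K. p i * M j i)"
        unfolding p_def by (rule step_LBINT(2)[OF assms(7,8) qle]) (use A Msym that in auto)
      then show ?thesis by (simp add: d_def)
    qed
    then have "(LBINT y:{0..<1}. LBINT x:{0..<1}. A x y) = (\<Sum>j<K. p j * d j)"
      unfolding p_def by (intro step_LBINT(2)[OF assms(7,8) qle]) auto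
    then show ?thesis using assms(5) by simp
  qed
  finally have "S A \<le> max (star_value c) (sqrt (c ^ 5))" .
  moreover have "sqrt (c ^ 5) = c powr (5 / 2)"
    using assms(1) by (simp add: powr_half_sqrt[symmetric] powr_powr flip: powr_numeral)
  ultimately show ?thesis
    using S_A1[OF assms(1,2)] S_A2[OF assms(1,2)] by (simp add: star_value_def)
qed

end
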